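(* Consider the switched descriptor system $E_{\sigma(t)}\dot x=A_{\sigma(t)}x$, $\sigma(t)\in\{1,2\}$, with $E_i,A_i\in\mathbb{R}^{n\times n}$, $A_1,A_2$ nonsingular. For $i=1,2$ let $(X_i,Y_i)$ be a full rank decomposition of $E_i$ with $X_i,Y_i\in\mathbb{R}^{n\times r}$ (so $\mathrm{rank}\,E_1=\mathrm{rank}\,E_2=r$), and set $\tilde E_i=Y_i^TA_i^{-1}X_i\in\mathbb{R}^{r\times r}$. Assume that for every solution, $Y_j^Tx(t_*^+)=Y_i^Tx(t_*^-)$ whenever $\sigma$ switches from $i$ to $j$ at $t_*$. Suppose: (a) $(E_1,A_1)$ and $(E_2,A_2)$ are stable; (b) $(E_1,A_1)$ has index one and $(E_2,A_2)$ has index two; (c) there exist vectors $g,h\in\mathbb{R}^r$ with $\tilde E_2=\tilde E_1-gh^T$, where $(\tilde E_1,g)$ is controllable and $(\tilde E_1,h)$ is observable (i.e. $(h^T,\tilde E_1)$ is an observable pair); (d) $\tilde E_1\tilde E_2$ has no negative real eigenvalues and exactly one zero eigenvalue. Then the switched system is GUES.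
   Context: For $E,A\in\mathbb{R}^{n\times n}$ with $A$ nonsingular, $(E,A)$ denotes the descriptor system $E\dot x=Ax$. It is stable if every root $s$ of $\det(sE-A)=0$ has negative real part. Its index is the smallest integer $k^*\ge0$ with $\mathrm{Im}((A^{-1}E)^{k^*+1})=\mathrm{Im}((A^{-1}E)^{k^*})$, and its consistency space is $\mathcal{C}(E,A)=\mathrm{Im}((A^{-1}E)^{k^*})$. A full rank decomposition of $E$ is a pair $(X,Y)$ of matrices with full column rank such that $E=XY^T$. Switched descriptor system: the switching signal $\sigma$ is piecewise constant with finitely many discontinuities in every bounded interval; a solution $x(\cdot)$ is differentiable and satisfies $E_{\sigma(t)}\dot x(t)=A_{\sigma(t)}x(t)$ at every $t$ where $\sigma$ is continuous, with one-sided limits $x(t_*^\pm)$ at discontinuities of $\sigma$ (the equation is not required there). The system is GUES if there exist $\beta,\alpha>0$ such that every solution satisfies $\|x(t)\|\le\beta e^{-\alpha(t-t_0)}\|x(t_0)\|$ for all $t\ge t_0$. *)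

theory Defs
  imports "HOL-Analysis.Analysis" "HOL-Computational_Algebra.Polynomial"
begin

text \<open>Matrix power with respect to the matrix product (note: the power
  operation of the vec type is componentwise, hence this separate definition).\<close>
definition matpow :: "'a::comm_ring_1^'n^'n \<Rightarrow> nat \<Rightarrow> 'a^'n^'n" where
  "matpow M k = (((**) M) ^^ k) (mat 1)"

text \<open>Image (column space) of a real matrix.\<close>
definition mat_image :: "real^'n^'m \<Rightarrow> (real^'m) set" where
  "mat_image M = range (\<lambda>v. M *v v)"

text \<open>Index of the descriptor system (E,A), A nonsingular.\<close>
definition desc_index :: "real^'n^'n \<Rightarrow> real^'n^'n \<Rightarrow> nat" where
  "desc_index E A =
     (LEAST k. mat_image (matpow (matrix_inv A ** E) (Suc k)) = mat_image (matpow (matrix_inv A ** E) k))"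

text \<open>Stability: every (complex) root s of det(sE - A) = 0 has negative real part.\<close>
definition desc_stable :: "real^'n^'n \<Rightarrow> real^'n^'n \<Rightarrow> bool" where
  "desc_stable E A \<longleftrightarrow>
     (\<forall>s::complex. det (\<chi> i j. s * complex_of_real (E$i$j) - complex_of_real (A$i$j)) = 0 \<longrightarrow> Re s < 0)"

text \<open>Full rank decomposition E = X Y^T with X, Y of full column rank.\<close>
definition full_rank_decomp :: "real^'n^'n \<Rightarrow> real^'r^'n \<Rightarrow> real^'r^'n \<Rightarrow> bool" where
  "full_rank_decomp E X Y \<longleftrightarrow> rank X = CARD('r) \<and> rank Y = CARD('r) \<and> E = X ** transpose Y"

text \<open>Controllability of the pair (M, g): the Krylov vectors M^k g, k < r, span R^r
  (Kalman rank condition).\<close>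
definition controllable :: "real^'r^'r \<Rightarrow> real^'r \<Rightarrow> bool" where
  "controllable M g \<longleftrightarrow> span {matpow M k *v g | k. k < CARD('r)} = UNIV"

text \<open>Observability of the pair (h^T, M): the only vector v with h^T M^k v = 0
  for all k < r is v = 0 (Kalman rank condition on the observability matrix).\<close>
definition observable :: "real^'r \<Rightarrow> real^'r^'r \<Rightarrow> bool" where
  "observable h M \<longleftrightarrow> (\<forall>v. (\<forall>k < CARD('r). h \<bullet> (matpow M k *v v) = 0) \<longrightarrow> v = 0)"

text \<open>Characteristic polynomial det(sI - M).\<close>
definition char_poly :: "real^'r^'r \<Rightarrow> real poly" where
  "char_poly M = det (\<chi> i j. (if i = j then [:0, 1:] else 0) - [:M$i$j:])"

text \<open>Outer product g h^T.\<close>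
definition outer :: "real^'r \<Rightarrow> real^'r \<Rightarrow> real^'r^'r" where
  "outer g h = (\<chi> i j. g$i * h$j)"

text \<open>Switching signals with values in {1,2}: finitely many discontinuities in every
  bounded interval (hence piecewise constant).\<close>
definition switching_signal :: "(real \<Rightarrow> nat) \<Rightarrow> bool" where
  "switching_signal \<sigma> \<longleftrightarrow> (\<forall>t. \<sigma> t \<in> {1, 2}) \<and>
     (\<forall>a b. finite {t \<in> {a..b}. \<not> isCont \<sigma> t})"

text \<open>Solution on [t0, \<infinity>) of the switched descriptor system with jump rule
  Y_j^T x(t+) = Y_i^T x(t-) at a switch from i to j.  Convention: x is right-continuous
  at the switching instants and at t0 (x(t) = x(t+)).\<close>
definition switched_solution ::
  "(nat \<Rightarrow> real^'n^'n) \<Rightarrow> (nat \<Rightarrow> real^'n^'n) \<Rightarrow> (nat \<Rightarrow> real^'r^'n)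
    \<Rightarrow> (real \<Rightarrow> nat) \<Rightarrow> real \<Rightarrow> (real \<Rightarrow> real^'n) \<Rightarrow> bool" where
  "switched_solution E A Y \<sigma> t0 x \<longleftrightarrow>
     (x \<longlongrightarrow> x t0) (at_right t0) \<and>
     (\<forall>t > t0. isCont \<sigma> t \<longrightarrow>
        (\<exists>v. (x has_vector_derivative v) (at t) \<and> E (\<sigma> t) *v v = A (\<sigma> t) *v x t)) \<and>
     (\<forall>t > t0. \<not> isCont \<sigma> t \<longrightarrow>
        (\<exists>xm xp i j. (x \<longlongrightarrow> xm) (at_left t) \<and> (x \<longlongrightarrow> xp) (at_right t) \<and>
           (\<sigma> \<longlongrightarrow> i) (at_left t) \<and> (\<sigma> \<longlongrightarrow> j) (at_right t) \<and>
           x t = xp \<and> transpose (Y j) *v xp = transpose (Y i) *v xm))"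

text \<open>Global uniform exponential stability.\<close>
definition GUES ::
  "(nat \<Rightarrow> real^'n^'n) \<Rightarrow> (nat \<Rightarrow> real^'n^'n) \<Rightarrow> (nat \<Rightarrow> real^'r^'n) \<Rightarrow> bool" where
  "GUES E A Y \<longleftrightarrow> (\<exists>\<beta> > 0. \<exists>\<alpha> > 0. \<forall>\<sigma> t0 x.
     switching_signal \<sigma> \<and> switched_solution E A Y \<sigma> t0 x \<longrightarrow>
       (\<forall>t \<ge> t0. norm (x t) \<le> \<beta> * exp (- \<alpha> * (t - t0)) * norm (x t0)))"

end

theory Submission
  imports Defs "HOL-Computational_Algebra.Fundamental_Theorem_Algebra"
begin

text \<open>
  The variable \<open>y = Y\<^sub>i\<^sup>T x\<close> is continuous across switches and satisfies \<open>y = Et\<^sub>i y'\<close>,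
  while \<open>x = A\<^sub>i\<^sup>-\<^sup>1 X\<^sub>i y'\<close>; index one makes \<open>A = Et\<^sub>1\<close> nonsingular, index two makes the kernel and
  the image of \<open>B = Et\<^sub>2 = A - g h\<^sup>T\<close> intersect trivially. It therefore suffices to find \<open>P > 0\<close> with
  \<open>A\<^sup>T P + P A < 0\<close> and \<open>B\<^sup>T P + P B\<close> negative off the kernel of \<open>B\<close>.
  As in the Kalman-Yakubovich-Popov lemma one looks for a vector \<open>q\<close> with
  \<open>A\<^sup>T P + P A = - q q\<^sup>T - \<epsilon> B\<^sup>T B\<close> and \<open>P g = h - \<surd>2 q\<close>, because then
  \<open>B\<^sup>T P + P B = - (q - \<surd>2 h) (q - \<surd>2 h)\<^sup>T - \<epsilon> B\<^sup>T B\<close>.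
  With \<open>a\<close> the characteristic polynomial of \<open>A\<close> and \<open>H(s) = h\<^sup>T (s I - A)\<^sup>-\<^sup>1 g\<close>, the vector \<open>q\<close> comes
  from a spectral factorization of \<open>2 |a|\<^sup>2 (1 + Re H)\<close>, corrected by \<open>\<epsilon>\<close>, on the imaginary axis. The
  eigenvalue condition on \<open>A B\<close> says that \<open>1 + Re H(i\<omega>)\<close> is positive for \<open>\<omega> \<noteq> 0\<close> and has a zero of
  order exactly two at \<open>\<omega> = 0\<close>, which leaves room for the \<open>\<epsilon>\<close>-term.
\<close>

section \<open>Real polynomials on the imaginary axis\<close>

text \<open>The obstacle is that H(0) = -1. As \<open>B\<close> is singular, its kernel is spanned
  by the vector \<open>v\<close> with \<open>A v = g\<close>, and \<open>h \<bullet> v = 1\<close>;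
  hence 1 + Re H is only weakly positive and the strict form of the positive real lemma does not
  apply. The correction \<open>B\<^sup>T B\<close> is chosen to fit this defect: the resolvent
  vector at \<omega> = 0 is a multiple of \<open>v\<close>, so the correction also vanishes there to
  order at least two. After cancelling \<omega>^2 the remaining quotient is strictly positive, also
  in its leading coefficient, and a small \<epsilon> does no harm. What \<open>B\<^sup>T B\<close>
  misses, the direction \<open>v\<close>, is covered by \<open>q q\<^sup>T\<close>, because
  \<open>q \<bullet> v = sqrt 2\<close>. The eigenvalue condition enters through the vector 2 |a|^2
  Re ((i\<omega> I - A)^-1 g): \<open>A B\<close> multiplies it by -\<omega>^2, up to a term
  proportional to 1 + Re H. A zero of 1 + Re H at \<omega> \<noteq> 0 would thus give a negative
  eigenvalue. Everything is carried out with real polynomials; the substitution of -s for s takes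
  the place of complex conjugation.\<close>

abbreviation poly_refl :: "real poly \<Rightarrow> real poly" where
  "poly_refl p \<equiv> pcompose p [:0, -1:]"

text \<open>For real \<open>p\<close> and s = i\<omega>, p(-s) is the complex conjugate of p(s), and
  \<rho>(-s^2) becomes \<rho>(\<omega>^2). Squared moduli on the imaginary axis are thus polynomials
  in z = -s^2, and the axis itself is the half-line z \<ge> 0.\<close>

abbreviation poly_negsq :: "real poly \<Rightarrow> real poly" where
  "poly_negsq p \<equiv> pcompose p [:0, 0, -1:]"

text \<open>The monic irreducible real polynomial with the root \<open>\<mu> + i\<omega>\<close>.\<close>

definition root_factor :: "real \<Rightarrow> real \<Rightarrow> real poly" where
  "root_factor \<mu> \<omega> = (if \<omega> = 0 then [:-\<mu>, 1:] else [:\<mu>\<^sup>2 + \<omega>\<^sup>2, -2 * \<mu>, 1:])"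

text \<open>Phrased through real irreducible divisors, so that inductions can split off one factor
  at a time. Nonzero constants qualify, the zero polynomial does not.\<close>

definition hurwitz_poly :: "real poly \<Rightarrow> bool" where
  "hurwitz_poly p \<longleftrightarrow> (\<forall>\<mu> \<omega>. root_factor \<mu> \<omega> dvd p \<longrightarrow> \<mu> < 0)"

lemma poly_map_of_real_add:
  "poly (map_poly complex_of_real (p + q)) z = poly (map_poly of_real p) z + poly (map_poly of_real q) z"
  by (induction p q rule: poly_induct2) (simp_all add: map_poly_pCons algebra_simps)

lemma poly_map_of_real_smult:
  "poly (map_poly complex_of_real (smult c p)) z = of_real c * poly (map_poly of_real p) z"
  by (induction p) (simp_all add: map_poly_pCons algebra_simps)

lemma poly_map_of_real_mult:
  "poly (map_poly complex_of_real (p * q)) z = poly (map_poly of_real p) z * poly (map_poly of_real q) z"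
  by (induction p)
     (simp_all add: map_poly_pCons poly_map_of_real_add poly_map_of_real_smult algebra_simps)

lemma degree_root_factor: "degree (root_factor \<mu> \<omega>) > 0"
  by (simp add: root_factor_def)

lemma root_factor_nonzero: "root_factor \<mu> \<omega> \<noteq> 0"
  by (simp add: root_factor_def)

text \<open>The remainder modulo the factor of a complex root \<open>z\<close> still vanishes at
  \<open>z\<close>. It is constant if \<open>z\<close> is real and at most linear with real
  coefficients otherwise, so it must be zero.\<close>

lemma root_factor_exists:
  fixes p :: "real poly"
  assumes "degree p > 0"
  shows "\<exists>\<mu> \<omega>. root_factor \<mu> \<omega> dvd p"
proof -
  let ?C = "\<lambda>p z. poly (map_poly complex_of_real p) z"
  have "degree (map_poly complex_of_real p) = degree p"
    by (rule degree_map_poly) simp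
  hence "\<not> constant (poly (map_poly complex_of_real p))"
    using assms constant_degree by (metis less_nat_zero_code)
  then obtain z where z: "?C p z = 0"
    using fundamental_theorem_of_algebra by blast
  define c where "c = root_factor (Re z) (Im z)"
  have cz: "?C c z = 0"
    by (auto simp: c_def root_factor_def map_poly_pCons complex_eq_iff power2_eq_square algebra_simps)
  define m where "m = p mod c"
  have "p = c * (p div c) + m" by (simp add: m_def)
  hence mz: "?C m z = 0"
    using z cz by (metis add_0 mult_zero_left poly_map_of_real_add poly_map_of_real_mult)
  have "m = 0"
  proof (cases "Im z = 0")
    case True
    have "degree m = 0"
      using degree_mod_less[of c p] root_factor_nonzero
      by (auto simp: m_def c_def root_factor_def True)
    then obtain k where "m = [:k:]" using degree_eq_zeroE by blast
    thus ?thesis using mz by (simp add: map_poly_pCons)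
  next
    case False
    have dm: "degree m < 2"
      using degree_mod_less[of c p] root_factor_nonzero
      by (auto simp: m_def c_def root_factor_def False)
    have m: "m = [:coeff m 0, coeff m 1:]"
      using dm by (intro poly_eqI) (auto simp: coeff_pCons coeff_eq_0 split: nat.splits)
    have "?C [:coeff m 0, coeff m 1:] z = 0" using mz m by simp
    hence "coeff m 0 + coeff m 1 * Re z = 0" "coeff m 1 * Im z = 0"
      by (simp_all add: map_poly_pCons complex_eq_iff mult.commute)
    thus ?thesis using False m by simp
  qed
  hence "c dvd p" by (auto simp: m_def)
  thus ?thesis unfolding c_def by blast
qed

section \<open>Even polynomials, positivity in z = -s^2 and spectral factorization\<close>

lemma poly_eq_if_agree_at_squares:
  fixes p q :: "real poly"
  assumes "\<And>s. poly p (- s\<^sup>2) = poly q (- s\<^sup>2)"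
  shows "p = q"
proof (rule ccontr)
  assume "p \<noteq> q"
  hence "finite {x. poly (p - q) x = 0}" by (intro poly_roots_finite) simp
  moreover have "{..0::real} \<subseteq> {x. poly (p - q) x = 0}"
  proof
    fix x :: real assume "x \<in> {..0}"
    hence "x = - (sqrt (-x))\<^sup>2" by simp
    thus "x \<in> {x. poly (p - q) x = 0}" using assms[of "sqrt (-x)"] by simp
  qed
  ultimately show False using infinite_Iic finite_subset by blast
qed

lemma poly_eqI_fun:
  fixes p q :: "real poly"
  assumes "\<And>s. poly p s = poly q s"
  shows "p = q"
  using assms by (simp add: poly_eq_poly_eq_iff[symmetric] ext)

lemma even_poly_is_negsq:
  assumes "poly_refl R = R"
  shows "\<exists>\<rho>. R = poly_negsq \<rho>"
  using assms
proof (induction "degree R" arbitrary: R rule: less_induct)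
  case less
  show ?case
  proof (cases "degree R = 0")
    case True
    then obtain c where "R = [:c:]" using degree_eq_zeroE by blast
    thus ?thesis by (intro exI[of _ "[:c:]"]) simp
  next
    case False
    obtain c R1 where R1: "R = pCons c R1" by (cases R)
    obtain d R' where R': "R1 = pCons d R'" by (cases R1)
    have c: "(-1) ^ i * coeff R i = coeff R i" for i
      using less.prems coeff_pcompose_linear[of R "-1" i] by simp
    from c[of 1] have d: "d = 0" by (simp add: R1 R')
    have "(-1) ^ i * coeff R' i = coeff R' i" for i
      using c[of "Suc (Suc i)"] by (simp add: R1 R')
    hence e: "poly_refl R' = R'" by (intro poly_eqI) (simp add: coeff_pcompose_linear)
    have "R' \<noteq> 0" using False by (auto simp: R1 R' d)
    hence "degree R' < degree R" by (simp add: R1 R')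
    then obtain \<rho> where "R' = poly_negsq \<rho>" using less.hyps e by blast
    \<comment> \<open>Here R = c + s^2 R', and s^2 = -z for z = -s^2, whence the sign of
      \<rho>.\<close>
    hence "R = poly_negsq (pCons c (- \<rho>))"
      by (simp add: R1 R' d pcompose_pCons pcompose_uminus)
    thus ?thesis by blast
  qed
qed

lemma poly_refl_invol [simp]: "poly_refl (poly_refl p) = p"
  by (rule poly_eqI_fun) (simp add: poly_pcompose)

lemma hurwitz_poly_dvd: "hurwitz_poly p \<Longrightarrow> q dvd p \<Longrightarrow> hurwitz_poly q"
  unfolding hurwitz_poly_def using dvd_trans by blast

lemma hurwitz_poly_norm_imaginary_axis:
  assumes "hurwitz_poly p" "p \<noteq> 0"
  shows "\<exists>\<alpha>. p * poly_refl p = poly_negsq \<alpha> \<and> (\<forall>z\<ge>0. poly \<alpha> z > 0)"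
  using assms
proof (induction "degree p" arbitrary: p rule: less_induct)
  case less
  show ?case
  proof (cases "degree p = 0")
    case True
    then obtain c where "p = [:c:]" using degree_eq_zeroE by blast
    thus ?thesis using less.prems by (intro exI[of _ "[:c*c:]"]) (auto simp: zero_less_mult_iff)
  next
    case False
    then obtain \<mu> \<omega> where rf: "root_factor \<mu> \<omega> dvd p" using root_factor_exists by blast
    hence mu: "\<mu> < 0" using less.prems by (auto simp: hurwitz_poly_def)
    obtain b where b: "p = root_factor \<mu> \<omega> * b" using rf by (auto simp: dvd_def)
    have b0: "b \<noteq> 0" using b less.prems by auto
    have "degree b < degree p" using b b0 root_factor_nonzero[of \<mu> \<omega>] degree_root_factor[of \<mu> \<omega>]
      by (simp add: degree_mult_eq)
    moreover have "hurwitz_poly b" using hurwitz_poly_dvd less.prems b by auto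
    ultimately obtain \<beta> where \<beta>: "b * poly_refl b = poly_negsq \<beta>" "\<forall>z\<ge>0. poly \<beta> z > 0"
      using less.hyps b0 by blast
    have p: "p * poly_refl p = (root_factor \<mu> \<omega> * poly_refl (root_factor \<mu> \<omega>)) * poly_negsq \<beta>"
      unfolding \<beta>(1)[symmetric] by (simp add: b pcompose_mult)
    define \<gamma> where "\<gamma> = (if \<omega> = 0 then [:\<mu>\<^sup>2, 1:]
      else [:(\<mu>\<^sup>2 + \<omega>\<^sup>2)\<^sup>2, 4 * \<mu>\<^sup>2 - 2 * (\<mu>\<^sup>2 + \<omega>\<^sup>2), 1:])"
    have g: "root_factor \<mu> \<omega> * poly_refl (root_factor \<mu> \<omega>) = poly_negsq \<gamma>"
      by (rule poly_eqI_fun)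
         (simp add: poly_pcompose root_factor_def \<gamma>_def algebra_simps power2_eq_square)
    have "poly \<gamma> z > 0" if "z \<ge> 0" for z
    proof (cases "\<omega> = 0")
      case True thus ?thesis using that mu by (simp add: \<gamma>_def add_pos_nonneg)
    next
      case False
      \<comment> \<open>The sum of squares of the real and imaginary part of the factor at i sqrt z.
        For z > 0 the second summand is positive because \<mu> \<noteq> 0; at z = 0 the first one
        is.\<close>
      have e: "poly \<gamma> z = (\<mu>\<^sup>2 + \<omega>\<^sup>2 - z)\<^sup>2 + 4 * \<mu>\<^sup>2 * z"
        using False by (simp add: \<gamma>_def algebra_simps power2_eq_square)
      show ?thesis
      proof (cases "z = 0")
        case True
        thus ?thesis using e mu by (simp add: sum_power2_eq_zero_iff)
      next
        case F: False
        hence "4 * \<mu>\<^sup>2 * z > 0" using mu that by simp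
        thus ?thesis unfolding e by (intro add_nonneg_pos) auto
      qed
    qed
    thus ?thesis using p g \<beta>(2)
      by (intro exI[of _ "\<gamma> * \<beta>"]) (simp add: pcompose_mult)
  qed
qed

text \<open>Both sides are multiplicative, so it suffices to factor each irreducible factor of
  \<rho>. A linear one has a negative root by positivity; a quadratic one is positive
  everywhere.\<close>

lemma spectral_factor:
  assumes "\<And>z. z \<ge> 0 \<Longrightarrow> poly \<rho> z > 0"
  shows "\<exists>d. d * poly_refl d = poly_negsq \<rho>"
  using assms
proof (induction "degree \<rho>" arbitrary: \<rho> rule: less_induct)
  case less
  show ?case
  proof (cases "degree \<rho> = 0")
    case True
    then obtain c where c: "\<rho> = [:c:]" using degree_eq_zeroE by blast
    hence "c > 0" using less.prems[of 0] by simp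
    thus ?thesis using c by (intro exI[of _ "[:sqrt c:]"]) simp
  next
    case False
    then obtain \<mu> \<omega> where rf: "root_factor \<mu> \<omega> dvd \<rho>" using root_factor_exists by blast
    obtain b where b: "\<rho> = root_factor \<mu> \<omega> * b" using rf by (auto simp: dvd_def)
    have b0: "b \<noteq> 0" using b False by auto
    have mu: "\<mu> < 0" if "\<omega> = 0"
    proof (rule ccontr)
      assume "\<not> \<mu> < 0"
      hence "poly \<rho> \<mu> > 0" by (intro less.prems) simp
      thus False using that by (simp add: b root_factor_def)
    qed
    have rp: "poly (root_factor \<mu> \<omega>) z > 0" if "z \<ge> 0" for z
    proof (cases "\<omega> = 0")
      case True thus ?thesis using mu that by (simp add: root_factor_def)
    next
      case False
      have "poly (root_factor \<mu> \<omega>) z = (z - \<mu>)\<^sup>2 + \<omega>\<^sup>2"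
        using False by (simp add: root_factor_def algebra_simps power2_eq_square)
      thus ?thesis using False by (simp add: add_nonneg_pos)
    qed
    have "degree b < degree \<rho>"
      using b b0 root_factor_nonzero[of \<mu> \<omega>] degree_root_factor[of \<mu> \<omega>]
      by (simp add: degree_mult_eq)
    moreover have "poly b z > 0" if "z \<ge> 0" for z
      using less.prems[OF that] rp[OF that] by (simp add: b zero_less_mult_iff)
    ultimately obtain e where e: "e * poly_refl e = poly_negsq b" using less.hyps by blast
    \<comment> \<open>Comparing (s^2 + \<alpha> s + \<beta>)(s^2 - \<alpha> s + \<beta>) with s^4 +
      2 \<mu> s^2 + \<mu>^2 + \<omega>^2 forces \<beta>^2 = \<mu>^2 + \<omega>^2 and \<alpha>^2 = 2
      (\<beta> - \<mu>).\<close>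
    define \<beta> where "\<beta> = sqrt (\<mu>\<^sup>2 + \<omega>\<^sup>2)"
    have b2: "\<beta> * \<beta> = \<mu>\<^sup>2 + \<omega>\<^sup>2" by (simp add: \<beta>_def)
    have "\<mu> \<le> \<beta>" unfolding \<beta>_def using real_sqrt_sum_squares_ge1 by blast
    define \<alpha> where "\<alpha> = sqrt (2 * (\<beta> - \<mu>))"
    have a2: "\<alpha> * \<alpha> = 2 * (\<beta> - \<mu>)" using \<open>\<mu> \<le> \<beta>\<close> by (simp add: \<alpha>_def)
    define f where "f = (if \<omega> = 0 then [:sqrt (-\<mu>), 1:] else [:\<beta>, \<alpha>, 1:])"
    have "f * poly_refl f = poly_negsq (root_factor \<mu> \<omega>)"
    proof (rule poly_eqI_fun)
      fix s
      show "poly (f * poly_refl f) s = poly (poly_negsq (root_factor \<mu> \<omega>)) s"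
      proof (cases "\<omega> = 0")
        case True
        have "sqrt (-\<mu>) * sqrt (-\<mu>) = -\<mu>" using mu[OF True] by simp
        thus ?thesis using True by (simp add: f_def root_factor_def poly_pcompose algebra_simps)
      next
        case False
        have "poly (f * poly_refl f) s = \<beta> * \<beta> + s * s * (2 * \<beta> - \<alpha> * \<alpha>) + s * s * (s * s)"
          using False by (simp add: f_def poly_pcompose algebra_simps)
        thus ?thesis unfolding a2 b2 using False
          by (simp add: root_factor_def poly_pcompose algebra_simps)
      qed
    qed
    hence "(f * poly_refl f) * (e * poly_refl e) = poly_negsq \<rho>"
      using e by (simp add: b pcompose_mult)
    moreover have "(f * e) * poly_refl (f * e) = (f * poly_refl f) * (e * poly_refl e)"
      unfolding pcompose_mult by (simp only: mult_ac)
    ultimately have "(f * e) * poly_refl (f * e) = poly_negsq \<rho>" by simp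
    thus ?thesis by blast
  qed
qed

text \<open>The degree bound gives q/p a finite limit at infinity, and q/p is continuous on compact
  intervals, so |q/p| has a strict bound M on the half-line; then \<epsilon> = 1/M.\<close>

lemma poly_perturb_pos:
  fixes p q :: "real poly"
  assumes pos: "\<And>z. z \<ge> 0 \<Longrightarrow> poly p z > 0" and deg: "degree q \<le> degree p"
  shows "\<exists>\<epsilon>>0. \<forall>z\<ge>0. poly (p - smult \<epsilon> q) z > 0"
proof -
  have ppos: "p \<noteq> 0" using pos[of 0] by auto
  define n where "n = degree p"
  have "((\<lambda>z. poly p z / z ^ n) \<longlongrightarrow> lead_coeff p) at_infinity"
    unfolding n_def by (rule poly_divide_tendsto_aux)
  hence lp: "((\<lambda>z. poly p z / z ^ n) \<longlongrightarrow> lead_coeff p) at_top"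
    using at_top_le_at_infinity tendsto_mono by blast
  have "((\<lambda>z. poly q z / z ^ degree q * (1 / z ^ (n - degree q)))
        \<longlongrightarrow> lead_coeff q * (if n = degree q then 1 else 0)) at_top"
  proof (rule tendsto_mult)
    show "((\<lambda>z. poly q z / z ^ degree q) \<longlongrightarrow> lead_coeff q) at_top"
      using poly_divide_tendsto_aux[of q] at_top_le_at_infinity tendsto_mono by blast
    show "((\<lambda>z::real. 1 / z ^ (n - degree q)) \<longlongrightarrow> (if n = degree q then 1 else 0)) at_top"
    proof (cases "n = degree q")
      case False
      hence "n - degree q > 0" using deg n_def by simp
      hence "filterlim (\<lambda>z::real. z ^ (n - degree q)) at_top at_top"
        using filterlim_pow_at_top[OF _ filterlim_ident] by blast
      hence "((\<lambda>z::real. 1 / z ^ (n - degree q)) \<longlongrightarrow> 0) at_top"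
        by (intro tendsto_divide_0[OF tendsto_const]) (rule filterlim_at_top_imp_at_infinity)
      thus ?thesis using False by simp
    qed auto
  qed
  moreover have "eventually (\<lambda>z::real. poly q z / z ^ degree q * (1 / z ^ (n - degree q)) = poly q z / z ^ n) at_top"
    using eventually_gt_at_top[of 0]
  proof eventually_elim
    case (elim z)
    have "z ^ n = z ^ degree q * z ^ (n - degree q)"
      using deg n_def by (simp flip: power_add)
    thus ?case by simp
  qed
  ultimately obtain l where lq: "((\<lambda>z. poly q z / z ^ n) \<longlongrightarrow> l) at_top"
    using Lim_transform_eventually by fast
  have "((\<lambda>z. (poly q z / z ^ n) / (poly p z / z ^ n)) \<longlongrightarrow> l / lead_coeff p) at_top"
    using lp lq ppos by (intro tendsto_divide) auto
  moreover have "eventually (\<lambda>z::real. (poly q z / z ^ n) / (poly p z / z ^ n) = poly q z / poly p z) at_top"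
    using eventually_gt_at_top[of 0] by eventually_elim simp
  ultimately have "((\<lambda>z. poly q z / poly p z) \<longlongrightarrow> l / lead_coeff p) at_top"
    using Lim_transform_eventually by fast
  hence "eventually (\<lambda>z. dist (poly q z / poly p z) (l / lead_coeff p) < 1) at_top"
    by (rule tendstoD) simp
  then obtain N where N: "\<And>z. z \<ge> N \<Longrightarrow> dist (poly q z / poly p z) (l / lead_coeff p) < 1"
    by (auto simp: eventually_at_top_linorder)
  have "continuous_on {0..N} (\<lambda>z. poly q z / poly p z)"
    using pos by (intro continuous_intros) (auto simp: less_le)
  hence "bounded ((\<lambda>z. poly q z / poly p z) ` {0..N})"
    by (intro compact_imp_bounded compact_continuous_image) auto
  then obtain K where "\<forall>x\<in>(\<lambda>z. poly q z / poly p z) ` {0..N}. norm x \<le> K"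
    unfolding bounded_iff by blast
  hence K: "\<bar>poly q z / poly p z\<bar> \<le> K" if "z \<in> {0..N}" for z
    using that unfolding real_norm_def by blast
  define M where "M = max (max K 0) (\<bar>l / lead_coeff p\<bar> + 1) + 1"
  have M: "\<bar>poly q z / poly p z\<bar> < M" if "z \<ge> 0" for z
  proof (cases "z \<le> N")
    case True thus ?thesis using K[of z] that by (auto simp: M_def)
  next
    case False
    hence "\<bar>poly q z / poly p z - l / lead_coeff p\<bar> < 1" using N[of z] by (simp add: dist_real_def)
    hence "\<bar>poly q z / poly p z\<bar> < \<bar>l / lead_coeff p\<bar> + 1" by linarith
    thus ?thesis unfolding M_def by linarith
  qed
  have "M > 0" by (auto simp: M_def)
  have "poly (p - smult (1 / M) q) z > 0" if "z \<ge> 0" for z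
  proof -
    have "poly q z < M * poly p z"
      using M[OF that] pos[OF that] by (auto simp: abs_less_iff field_simps)
    thus ?thesis using \<open>M > 0\<close> by (simp add: field_simps)
  qed
  thus ?thesis using \<open>M > 0\<close> by (intro exI[of _ "1 / M"]) auto
qed

section \<open>Polynomials in a matrix and Krylov vectors\<close>

text \<open>The vector p(A) x, formed without the matrix p(A): annihilation is only ever tested on
  single vectors.\<close>

definition poly_apply :: "real poly \<Rightarrow> real^'r^'r \<Rightarrow> real^'r \<Rightarrow> real^'r" where
  "poly_apply p A x = (\<Sum>k\<le>degree p. coeff p k *\<^sub>R (((*v) A) ^^ k) x)"

text \<open>The pair \<open>(p, q)\<close> encodes the complex eigenvector \<open>p + iq\<close> for the eigenvalue \<open>\<mu> + i\<omega>\<close>.\<close>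

definition hurwitz_mat :: "real^'r^'r \<Rightarrow> bool" where
  "hurwitz_mat A \<longleftrightarrow> (\<forall>\<mu> \<omega> p q. A *v p = \<mu> *\<^sub>R p - \<omega> *\<^sub>R q \<and> A *v q = \<omega> *\<^sub>R p + \<mu> *\<^sub>R q
     \<and> (p \<noteq> 0 \<or> q \<noteq> 0) \<longrightarrow> \<mu> < 0)"

lemma funpow_matvec: "(((*v) A) ^^ k) x = matpow A k *v (x :: real^'r)"
  by (induction k) (simp_all add: matpow_def matrix_vector_mul_assoc)

lemma poly_apply_sum_upto:
  assumes "degree p \<le> n"
  shows "poly_apply p A x = (\<Sum>k\<le>n. coeff p k *\<^sub>R (((*v) A) ^^ k) x)"
  unfolding poly_apply_def using assms
  by (intro sum.mono_neutral_left) (auto simp: coeff_eq_0)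

lemma poly_apply_0 [simp]: "poly_apply 0 A x = 0"
  by (simp add: poly_apply_def)

lemma poly_apply_pCons [simp]: "poly_apply (pCons c p) A x = c *\<^sub>R x + A *v poly_apply p A x"
proof -
  have "poly_apply (pCons c p) A x
      = (\<Sum>k\<le>Suc (degree p). coeff (pCons c p) k *\<^sub>R (((*v) A) ^^ k) x)"
    by (rule poly_apply_sum_upto) (rule degree_pCons_le)
  also have "\<dots> = c *\<^sub>R x + (\<Sum>k\<le>degree p. coeff p k *\<^sub>R (A *v (((*v) A) ^^ k) x))"
    by (subst sum.atMost_Suc_shift) simp
  also have "(\<Sum>k\<le>degree p. coeff p k *\<^sub>R (A *v (((*v) A) ^^ k) x)) = A *v poly_apply p A x"
    by (simp add: poly_apply_def linear_sum[OF matrix_vector_mul_linear] matrix_vector_mult_scaleR)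
  finally show ?thesis .
qed

lemma poly_apply_add: "poly_apply (p + q) A x = poly_apply p A x + poly_apply q A x"
  by (induction p q rule: poly_induct2) (simp_all add: algebra_simps matrix_vector_right_distrib)

lemma poly_apply_smult: "poly_apply (smult c p) A x = c *\<^sub>R poly_apply p A x"
  by (induction p) (simp_all add: algebra_simps matrix_vector_mult_scaleR)

lemma poly_apply_vec_add: "poly_apply p A (x + y) = poly_apply p A x + poly_apply p A y"
  by (induction p) (simp_all add: algebra_simps matrix_vector_right_distrib)

lemma poly_apply_vec_scaleR: "poly_apply p A (c *\<^sub>R x) = c *\<^sub>R poly_apply p A x"
  by (induction p) (simp_all add: algebra_simps matrix_vector_mult_scaleR)

lemma linear_poly_apply: "linear (poly_apply p A)"
  by (intro linearI poly_apply_vec_add poly_apply_vec_scaleR)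

lemma poly_apply_vec_0 [simp]: "poly_apply p A 0 = 0"
  by (rule linear_0[OF linear_poly_apply])

lemma poly_apply_matvec: "poly_apply p A (A *v x) = A *v poly_apply p A x"
  by (induction p) (simp_all add: matrix_vector_right_distrib matrix_vector_mult_scaleR)

lemma poly_apply_mult: "poly_apply (p * q) A x = poly_apply p A (poly_apply q A x)"
  by (induction p) (simp_all add: poly_apply_add poly_apply_smult)

lemma poly_apply_mult': "poly_apply (p * q) A x = poly_apply q A (poly_apply p A x)"
  by (metis mult.commute poly_apply_mult)

text \<open>For \<omega> \<noteq> 0 the first equation determines \<open>q\<close>, the imaginary
  part of an eigenvector with real part \<open>e\<close>; the quadratic relation for
  \<open>e\<close> then yields the second equation.\<close>

lemma poly_apply_root_factor_eigenpair:
  assumes "poly_apply (root_factor \<mu> \<omega>) A e = 0"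
  shows "\<exists>q. A *v e = \<mu> *\<^sub>R e - \<omega> *\<^sub>R q \<and> A *v q = \<omega> *\<^sub>R e + \<mu> *\<^sub>R q"
proof (cases "\<omega> = 0")
  case True
  thus ?thesis using assms by (intro exI[of _ 0]) (simp add: root_factor_def)
next
  case False
  define q where "q = (1 / \<omega>) *\<^sub>R (\<mu> *\<^sub>R e - A *v e)"
  have AA: "A *v (A *v e) = (2 * \<mu>) *\<^sub>R (A *v e) - (\<mu>\<^sup>2 + \<omega>\<^sup>2) *\<^sub>R e"
    using assms False
    by (simp add: root_factor_def matrix_vector_right_distrib matrix_vector_mult_scaleR algebra_simps
        add_eq_0_iff2 matrix_vector_mult_diff_distrib)
  have wq: "\<omega> *\<^sub>R q = \<mu> *\<^sub>R e - A *v e" using False by (simp add: q_def)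
  have "\<omega> *\<^sub>R (A *v q) = A *v (\<omega> *\<^sub>R q)" by (simp add: matrix_vector_mult_scaleR)
  also have "\<dots> = \<mu> *\<^sub>R (A *v e) - ((2 * \<mu>) *\<^sub>R (A *v e) - (\<mu>\<^sup>2 + \<omega>\<^sup>2) *\<^sub>R e)"
    unfolding wq by (simp add: matrix_vector_mult_diff_distrib matrix_vector_mult_scaleR AA)
  also have "\<dots> = \<omega> *\<^sub>R (\<omega> *\<^sub>R e) + \<mu> *\<^sub>R (\<mu> *\<^sub>R e - A *v e)"
    by (simp add: vec_eq_iff algebra_simps power2_eq_square)
  also have "\<dots> = \<omega> *\<^sub>R (\<omega> *\<^sub>R e + \<mu> *\<^sub>R q)"
    unfolding wq[symmetric] by (simp add: algebra_simps)
  finally have "A *v q = \<omega> *\<^sub>R e + \<mu> *\<^sub>R q" using False by simp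
  thus ?thesis using wq by (intro exI[of _ q]) simp
qed

lemma hurwitz_mat_root_factor:
  assumes "hurwitz_mat A" "e \<noteq> 0" "poly_apply (root_factor \<mu> \<omega>) A e = 0"
  shows "\<mu> < 0"
  using poly_apply_root_factor_eigenpair[OF assms(3)] assms(1,2) unfolding hurwitz_mat_def by blast

text \<open>Applying the irreducible factors of \<open>c\<close> to \<open>u\<close> one after the
  other, some factor is the first to send a nonzero vector to zero.\<close>

lemma poly_apply_kernel_root_factor:
  assumes "c \<noteq> 0" "u \<noteq> 0" "poly_apply c A u = 0"
  shows "\<exists>\<mu> \<omega> e. e \<noteq> 0 \<and> root_factor \<mu> \<omega> dvd c \<and> poly_apply (root_factor \<mu> \<omega>) A e = 0"
  using assms
proof (induction "degree c" arbitrary: c u rule: less_induct)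
  case less
  show ?case
  proof (cases "degree c = 0")
    case True
    then obtain k where "c = [:k:]" using degree_eq_zeroE by blast
    thus ?thesis using less.prems by simp
  next
    case False
    then obtain \<mu> \<omega> where rf: "root_factor \<mu> \<omega> dvd c" using root_factor_exists by blast
    then obtain b where b: "c = root_factor \<mu> \<omega> * b" by (auto simp: dvd_def)
    have b0: "b \<noteq> 0" using b less.prems by auto
    have deg: "degree b < degree c"
      using b b0 root_factor_nonzero[of \<mu> \<omega>] degree_root_factor[of \<mu> \<omega>]
      by (simp add: degree_mult_eq)
    show ?thesis
    proof (cases "poly_apply b A u = 0")
      case True
      then obtain \<mu>' \<omega>' e where "e \<noteq> 0" "root_factor \<mu>' \<omega>' dvd b"
          "poly_apply (root_factor \<mu>' \<omega>') A e = 0"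
        using less.hyps[OF deg b0 less.prems(2)] by blast
      thus ?thesis using b by (metis dvd_mult)
    next
      case False
      moreover have "poly_apply (root_factor \<mu> \<omega>) A (poly_apply b A u) = 0"
        using less.prems(3) by (simp add: b poly_apply_mult)
      ultimately show ?thesis using rf by blast
    qed
  qed
qed

lemma poly_refl_root_factor: 
  "root_factor \<mu> \<omega> dvd poly_refl p \<Longrightarrow> root_factor (-\<mu>) \<omega> dvd p"
proof -
  assume "root_factor \<mu> \<omega> dvd poly_refl p"
  then obtain b where b: "poly_refl p = root_factor \<mu> \<omega> * b" by (auto simp: dvd_def)
  have r: "poly_refl (root_factor \<mu> \<omega>) = smult (if \<omega> = 0 then -1 else 1) (root_factor (-\<mu>) \<omega>)"
    by (rule poly_eqI_fun) (simp add: poly_pcompose root_factor_def algebra_simps)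
  have "p = poly_refl (root_factor \<mu> \<omega>) * poly_refl b"
    using arg_cong[OF b, of poly_refl] by (simp add: pcompose_mult)
  hence "p = root_factor (-\<mu>) \<omega> * smult (if \<omega> = 0 then -1 else 1) (poly_refl b)"
    unfolding r by simp
  thus ?thesis by (rule dvdI)
qed

text \<open>The eigenvalues of \<open>A\<close> lie in the left half-plane, the roots of p(-s) in
  the right one, so p(-A) has trivial kernel. It serves to cancel p(-A), both for the uniqueness of
  Lyapunov solutions and for the equation \<open>P *v g = h - sqrt 2 *\<^sub>R q\<close>.\<close>

lemma hurwitz_poly_refl_apply_inj:
  assumes "hurwitz_mat A" "hurwitz_poly p" "p \<noteq> 0" "poly_apply (poly_refl p) A u = 0"
  shows "u = 0"
proof (rule ccontr)
  assume u: "u \<noteq> 0"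
  have "poly_refl p \<noteq> 0" using assms(3) by (simp add: pcompose_eq_0_iff)
  then obtain \<mu> \<omega> e where e: "e \<noteq> 0" "root_factor \<mu> \<omega> dvd poly_refl p"
      "poly_apply (root_factor \<mu> \<omega>) A e = 0"
    using poly_apply_kernel_root_factor[OF _ u assms(4)] by blast
  have "\<mu> < 0" using hurwitz_mat_root_factor assms(1) e by blast
  moreover have "-\<mu> < 0" using poly_refl_root_factor[OF e(2)] assms(2) unfolding hurwitz_poly_def by blast
  ultimately show False by simp
qed

text \<open>By minimality the cofactor of a root factor does not annihilate \<open>x\<close>; its
  value is a nonzero vector killed by the root factor, hence part of an eigenvector of
  \<open>A\<close>.\<close>

lemma minimal_poly_hurwitz:
  assumes "hurwitz_mat A" "a \<noteq> 0" "poly_apply a A x = 0"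
    and "\<And>b. b \<noteq> 0 \<Longrightarrow> degree b < degree a \<Longrightarrow> poly_apply b A x \<noteq> 0"
  shows "hurwitz_poly a"
  unfolding hurwitz_poly_def
proof (intro allI impI)
  fix \<mu> \<omega> assume "root_factor \<mu> \<omega> dvd a"
  then obtain b where b: "a = root_factor \<mu> \<omega> * b" by (auto simp: dvd_def)
  have b0: "b \<noteq> 0" using b assms by auto
  have deg: "degree b < degree a"
    using b b0 root_factor_nonzero[of \<mu> \<omega>] degree_root_factor[of \<mu> \<omega>]
    by (simp add: degree_mult_eq)
  have "poly_apply b A x \<noteq> 0" using assms(4) b0 deg by blast
  moreover have "poly_apply (root_factor \<mu> \<omega>) A (poly_apply b A x) = 0"
    using assms(3) by (simp add: b poly_apply_mult)
  ultimately show "\<mu> < 0" using hurwitz_mat_root_factor assms(1) by blast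
qed

section \<open>Krylov vectors; a bijection \<open>e\<close> turns indices of a finite type into
  exponents\<close>

lemma degree_lt_bij_coeffs:
  fixes e :: "'s::finite \<Rightarrow> nat"
  assumes "bij_betw e UNIV {..<n}" "degree p < n"
  shows "poly_apply p A x = (\<Sum>i\<in>UNIV. coeff p (e i) *\<^sub>R (((*v) A) ^^ e i) x)"
proof -
  have "poly_apply p A x = (\<Sum>k\<le>n-1. coeff p k *\<^sub>R (((*v) A) ^^ k) x)"
    using assms by (intro poly_apply_sum_upto) auto
  also have "{..n-1} = {..<n}" using assms by auto
  also have "(\<Sum>k<n. coeff p k *\<^sub>R (((*v) A) ^^ k) x) = (\<Sum>i\<in>UNIV. coeff p (e i) *\<^sub>R (((*v) A) ^^ e i) x)"
    by (rule sum.reindex_bij_betw[OF assms(1), symmetric])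
  finally show ?thesis .
qed

lemma poly_of_coeff_vec:
  fixes e :: "'s::finite \<Rightarrow> nat" and c :: "real^'s"
  assumes e: "bij_betw e UNIV {..<n}" and n: "n > 0"
  shows "\<exists>p::real poly. degree p < n \<and> (\<forall>i. coeff p (e i) = c $ i)"
proof -
  have inj: "inj e" using e by (simp add: bij_betw_def)
  define p :: "real poly" where "p = (\<Sum>i\<in>UNIV. monom (c $ i) (e i))"
  have lt: "e i < n" for i using e by (auto simp: bij_betw_def)
  have "degree p \<le> n - 1" unfolding p_def
  proof (rule degree_sum_le)
    show "degree (monom (c $ i) (e i)) \<le> n - 1" for i
      using lt[of i] degree_monom_le[of "c $ i" "e i"] by linarith
  qed simp
  moreover have "coeff p (e i) = c $ i" for i
  proof -
    have "coeff p (e i) = (\<Sum>j\<in>UNIV. if j = i then c $ j else 0)"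
      unfolding p_def coeff_sum by (intro sum.cong) (auto simp: inj_eq[OF inj])
    thus ?thesis by simp
  qed
  ultimately show ?thesis using n by (intro exI[of _ p]) auto
qed

lemma finite_index_bij: "\<exists>e. bij_betw e (UNIV :: 's::finite set) {..<CARD('s)}"
  using ex_bij_betw_finite_nat[of "UNIV :: 's set"] by (simp add: lessThan_atLeast0)

lemma annihilating_poly_exists:
  fixes A :: "real^'r^'r"
  shows "\<exists>p. p \<noteq> 0 \<and> poly_apply p A x = 0"
proof -
  \<comment> \<open>The type \<open>'r option\<close> has one element more than \<open>'r\<close>,
    so it indexes r + 1 Krylov vectors, which must be dependent.\<close>
  obtain e where e: "bij_betw e (UNIV :: 'r option set) {..<CARD('r option)}"
    using finite_index_bij by blast
  define f :: "real^('r option) \<Rightarrow> real^'r" where "f c = (\<Sum>i\<in>UNIV. c $ i *\<^sub>R (((*v) A) ^^ e i) x)" for c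
  have lin: "linear f"
    unfolding f_def by (intro linearI) (simp_all add: scaleR_add_left sum.distrib scaleR_sum_right)
  have "\<not> inj f"
  proof
    assume "inj f"
    hence "dim (range f) = dim (UNIV :: (real^('r option)) set)"
      by (intro dim_image_eq[OF lin]) (auto intro: inj_on_subset)
    moreover have "dim (range f) \<le> dim (UNIV :: (real^'r) set)" by (rule dim_subset) simp
    ultimately show False by (simp add: dim_UNIV)
  qed
  then obtain c where c: "f c = 0" "c \<noteq> 0" using linear_injective_0[OF lin] by auto
  obtain p :: "real poly" where p: "degree p < CARD('r option)" "\<And>i. coeff p (e i) = c $ i"
    using poly_of_coeff_vec[OF e, of c] by auto
  have "p \<noteq> 0" using p(2) c(2) by (auto simp: vec_eq_iff)
  moreover have "poly_apply p A x = 0"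
    using c(1) unfolding degree_lt_bij_coeffs[OF e p(1)] p(2) f_def .
  ultimately show ?thesis by blast
qed

lemma hurwitz_annihilating_poly:
  fixes A :: "real^'r^'r"
  assumes "hurwitz_mat A"
  shows "\<exists>p. p \<noteq> 0 \<and> poly_apply p A x = 0 \<and> hurwitz_poly p"
proof -
  define P where "P p \<longleftrightarrow> p \<noteq> 0 \<and> poly_apply p A x = 0" for p
  have "\<exists>p. P p" using annihilating_poly_exists P_def by blast
  then obtain p where p: "P p" "\<And>q. P q \<Longrightarrow> degree p \<le> degree q"
    using ex_has_least_nat[of P _ degree] by blast
  have "hurwitz_poly p"
  proof (rule minimal_poly_hurwitz[OF assms])
    show "p \<noteq> 0" "poly_apply p A x = 0" using p(1) by (auto simp: P_def)
    show "poly_apply b A x \<noteq> 0" if "b \<noteq> 0" "degree b < degree p" for b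
      using p(2)[of b] that unfolding P_def by auto
  qed
  thus ?thesis using p unfolding P_def by blast
qed

text \<open>Controllability makes the map from coefficients to Krylov combinations onto; between
  spaces of equal dimension it is then one-to-one.\<close>

lemma krylov_independent:
  fixes A :: "real^'r^'r"
  assumes "controllable A g" "degree p < CARD('r)" "poly_apply p A g = 0"
  shows "p = 0"
proof -
  obtain e where e: "bij_betw e (UNIV :: 'r set) {..<CARD('r)}"
    using finite_index_bij by blast
  define f :: "real^'r \<Rightarrow> real^'r" where "f c = (\<Sum>i\<in>UNIV. c $ i *\<^sub>R (((*v) A) ^^ e i) g)" for c
  have lin: "linear f"
    unfolding f_def by (intro linearI) (simp_all add: scaleR_add_left sum.distrib scaleR_sum_right)
  have "{matpow A k *v g | k. k < CARD('r)} \<subseteq> range f"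
  proof
    fix x assume "x \<in> {matpow A k *v g | k. k < CARD('r)}"
    then obtain k where k: "x = matpow A k *v g" "k < CARD('r)" by auto
    then obtain i where i: "e i = k" using e by (metis (no_types, lifting) bij_betw_def imageE lessThan_iff)
    have "f (axis i 1) = (\<Sum>j\<in>UNIV. (if j = i then (((*v) A) ^^ e j) g else 0))"
      unfolding f_def by (intro sum.cong) (auto simp: axis_def)
    also have "\<dots> = x" using i k by (simp add: funpow_matvec)
    finally show "x \<in> range f" by (metis rangeI)
  qed
  moreover have "subspace (range f)" using lin by (simp add: linear_subspace_image)
  ultimately have "span {matpow A k *v g | k. k < CARD('r)} \<subseteq> range f" by (rule span_minimal)
  hence "surj f" using assms(1) by (auto simp: controllable_def)
  hence inj: "inj f" using linear_surjective_imp_injective[OF lin] by simp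
  define c :: "real^'r" where "c = (\<chi> i. coeff p (e i))"
  have "f c = 0" using assms(3) unfolding degree_lt_bij_coeffs[OF e assms(2)] f_def c_def by simp
  hence "c = 0" using linear_injective_0[OF lin] inj by blast
  hence z: "coeff p (e i) = 0" for i by (simp add: c_def vec_eq_iff)
  have "coeff p k = 0" for k
  proof (cases "k < CARD('r)")
    case True
    then obtain i where "e i = k" using e by (metis (no_types, lifting) bij_betw_def imageE lessThan_iff)
    thus ?thesis using z by blast
  next
    case False thus ?thesis using assms(2) by (intro coeff_eq_0) simp
  qed
  thus ?thesis by (intro poly_eqI) simp
qed

text \<open>Expanding A^r g in the basis g, ..., A^(r-1) g produces the characteristic polynomial of
  \<open>A\<close> directly, in the only form required: through its action on
  \<open>g\<close>.\<close>

lemma krylov_char_poly: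
  fixes A :: "real^'r^'r"
  assumes c: "controllable A g"
  shows "\<exists>a. degree a = CARD('r) \<and> lead_coeff a = 1 \<and> poly_apply a A g = 0"
proof -
  have "\<exists>p. p \<noteq> 0 \<and> degree p \<le> CARD('r) \<and> poly_apply p A g = 0"
  proof -
    obtain e where e: "bij_betw e (UNIV :: 'r set) {..<CARD('r)}"
      using finite_index_bij by blast
    define f :: "real^'r \<Rightarrow> real^'r" where "f c = (\<Sum>i\<in>UNIV. c $ i *\<^sub>R (((*v) A) ^^ e i) g)" for c
    have lin: "linear f"
      unfolding f_def by (intro linearI) (simp_all add: scaleR_add_left sum.distrib scaleR_sum_right)
    have "inj f"
    proof (rule linear_injective_0[OF lin, THEN iffD2], intro allI impI)
      fix c assume "f c = 0"
      obtain p :: "real poly" where p: "degree p < CARD('r)" "\<And>i. coeff p (e i) = c $ i"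
        using poly_of_coeff_vec[OF e, of c] by auto
      have "poly_apply p A g = 0"
        using \<open>f c = 0\<close> unfolding degree_lt_bij_coeffs[OF e p(1)] p(2) f_def .
      hence "p = 0" using krylov_independent[OF c p(1)] by blast
      thus "c = 0" using p(2) by (simp add: vec_eq_iff)
    qed
    hence "surj f" using linear_injective_imp_surjective[OF lin] by simp
    then obtain c where cc: "(((*v) A) ^^ CARD('r)) g = f c" by (metis surjD)
    obtain p :: "real poly" where p: "degree p < CARD('r)" "\<And>i. coeff p (e i) = c $ i"
      using poly_of_coeff_vec[OF e, of c] by auto
    have "poly_apply p A g = f c"
      unfolding degree_lt_bij_coeffs[OF e p(1)] p(2) f_def ..
    moreover have "poly_apply (monom 1 n) A x = (((*v) A) ^^ n) x" for n and x :: "real^'r"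
      by (induction n) (simp_all add: monom_Suc monom_0)
    ultimately have "poly_apply (monom 1 CARD('r) + smult (-1) p) A g = 0"
      unfolding poly_apply_add poly_apply_smult by (simp add: cc)
    moreover have "coeff (monom 1 CARD('r) + smult (-1) p) CARD('r) = 1"
      using p(1) by (simp add: coeff_eq_0)
    hence "monom 1 CARD('r) + smult (-1) p \<noteq> 0" by auto
    moreover have "degree (monom 1 CARD('r) + smult (-1) p) \<le> CARD('r)"
      using p(1) by (intro degree_add_le) (auto simp: degree_monom_eq)
    ultimately show ?thesis by blast
  qed
  then obtain p where p: "p \<noteq> 0" "degree p \<le> CARD('r)" "poly_apply p A g = 0" by blast
  have "degree p = CARD('r)" using krylov_independent[OF c, of p] p by linarith
  moreover have "lead_coeff p \<noteq> 0" using p(1) by simp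
  ultimately show ?thesis using p
    by (intro exI[of _ "smult (1 / lead_coeff p) p"]) (simp add: poly_apply_smult)
qed

text \<open>This rule rewrites \<open>transpose A *v x\<close> to \<open>x v* A\<close> and would
  block \<open>inner_transpose_matvec\<close>.\<close>

declare transpose_matrix_vector [simp del]

section \<open>The Lyapunov equation\<close>

text \<open>Compactness of [0,1] times the unit sphere gives one \<open>c > 0\<close> with
  \<open>c * norm x \<le> norm (F t x)\<close> for all t. Solutions are therefore bounded by
  \<open>norm b / c\<close>, and subtracting the equations at t and s shows that they are Lipschitz
  in t.\<close>

lemma linear_homotopy_solution:
  fixes L M :: "'a::euclidean_space \<Rightarrow> 'a"
  assumes L: "linear L" and M: "linear M"
    and inj: "\<And>t x. t \<in> {0..1} \<Longrightarrow> (1 - t) *\<^sub>R L x + t *\<^sub>R M x = 0 \<Longrightarrow> x = 0"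
  shows "\<exists>X. continuous_on {0..1::real} X \<and> (\<forall>t\<in>{0..1}. (1 - t) *\<^sub>R L (X t) + t *\<^sub>R M (X t) = b)"
proof -
  define F where "F t x = (1 - t) *\<^sub>R L x + t *\<^sub>R M x" for t x
  have lin: "linear (F t)" for t
    unfolding F_def by (intro linear_compose_add linear_compose_scale_right L M)
  have bL: "bounded_linear L" and bM: "bounded_linear M"
    using L M by (simp_all add: linear_conv_bounded_linear)
  have "compact ({0..1::real} \<times> sphere (0::'a) 1)" by (intro compact_Times) auto
  moreover have "continuous_on ({0..1::real} \<times> sphere (0::'a) 1) (\<lambda>z. norm (F (fst z) (snd z)))"
    unfolding F_def
    by (intro continuous_intros bounded_linear.continuous_on[OF bL] bounded_linear.continuous_on[OF bM])
  moreover have "{0..1::real} \<times> sphere (0::'a) 1 \<noteq> {}"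
  proof -
    obtain u :: 'a where "u \<in> Basis" using nonempty_Basis by blast
    hence "(0, u) \<in> {0..1::real} \<times> sphere (0::'a) 1" by simp
    thus ?thesis by blast
  qed
  ultimately have "\<exists>z\<in>{0..1::real} \<times> sphere (0::'a) 1. \<forall>w\<in>{0..1::real} \<times> sphere (0::'a) 1.
      norm (F (fst z) (snd z)) \<le> norm (F (fst w) (snd w))"
    by (intro continuous_attains_inf)
  then obtain z where z: "z \<in> {0..1::real} \<times> sphere (0::'a) 1"
    "\<And>w. w \<in> {0..1::real} \<times> sphere (0::'a) 1 \<Longrightarrow> norm (F (fst z) (snd z)) \<le> norm (F (fst w) (snd w))"
    by (elim bexE) (rule that, auto)
  define c where "c = norm (F (fst z) (snd z))"
  have "snd z \<noteq> 0" using z(1) by auto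
  hence "F (fst z) (snd z) \<noteq> 0" using inj[of "fst z" "snd z"] z(1) unfolding F_def by (auto simp: mem_Times_iff)
  hence c: "c > 0" by (simp add: c_def)
  have lower: "c * norm x \<le> norm (F t x)" if "t \<in> {0..1}" for t x
  proof (cases "x = 0")
    case True thus ?thesis by simp
  next
    case False
    have "c \<le> norm (F t (x /\<^sub>R norm x))"
      using z(2)[of "(t, x /\<^sub>R norm x)"] that False by (simp add: c_def)
    also have "\<dots> = norm (F t x) / norm x"
      by (simp add: linear_scale[OF lin] divide_inverse mult.commute)
    finally show ?thesis using False by (simp add: field_simps)
  qed
  have "\<exists>x. F t x = b" if "t \<in> {0..1}" for t
  proof -
    have "inj (F t)"
      using linear_injective_0[OF lin] inj[OF that] unfolding F_def by blast
    thus ?thesis using linear_injective_imp_surjective[OF lin] by (metis surjD)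
  qed
  then obtain X where X: "\<And>t. t \<in> {0..1} \<Longrightarrow> F t (X t) = b" by metis
  obtain K where K: "K > 0" "\<And>x. norm (M x - L x) \<le> norm x * K"
    using bounded_linear.pos_bounded[OF bounded_linear_sub[OF bM bL]] by auto
  have lip: "norm (X t - X s) \<le> (norm b * K / (c * c)) * \<bar>t - s\<bar>" if ts: "t \<in> {0..1}" "s \<in> {0..1}" for t s
  proof -
    have "c * norm (X t - X s) \<le> norm (F t (X t - X s))" by (rule lower[OF ts(1)])
    also have "F t (X t - X s) = F s (X s) - F t (X s)"
      by (simp add: linear_diff[OF lin] X[OF ts(1)] X[OF ts(2)])
    also have "\<dots> = (s - t) *\<^sub>R (M (X s) - L (X s))"
      by (simp add: F_def algebra_simps)
    also have "norm \<dots> \<le> \<bar>t - s\<bar> * (norm (X s) * K)"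
      using K(2)[of "X s"] by (simp add: mult_left_mono abs_minus_commute)
    also have "\<dots> \<le> \<bar>t - s\<bar> * (norm b / c * K)"
    proof -
      have "norm (X s) \<le> norm b / c"
        using lower[OF ts(2), of "X s"] X[OF ts(2)] c by (simp add: field_simps)
      thus ?thesis using K(1) by (intro mult_left_mono mult_right_mono) auto
    qed
    finally show ?thesis using c by (simp add: field_simps)
  qed
  have "(norm b * K / (c * c))-lipschitz_on {0..1} X"
    using lip K(1) c by (intro lipschitz_onI) (auto simp: dist_norm)
  hence "continuous_on {0..1} X" by (rule lipschitz_on_continuous_on)
  thus ?thesis using X unfolding F_def by blast
qed

lemma matvec_uminus: "A *v (- x) = - (A *v (x :: real^'m))" for A :: "real^'m^'n"
  by (rule linear_neg[OF matrix_vector_mul_linear])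

lemma uminus_matvec: "(- A) *v x = - (A *v (x :: real^'m))" for A :: "real^'m^'n"
  by (simp add: vec_eq_iff matrix_vector_mult_def sum_negf)

lemma poly_apply_uminus: "poly_apply (- p) A x = - poly_apply p A x"
  using poly_apply_smult[of "-1" p A x] by simp

lemma inner_transpose_matvec: "x \<bullet> (transpose A *v y) = (A *v x) \<bullet> (y :: real^'n)"
  for A :: "real^'m^'n"
  by (metis dot_lmul_matrix inner_commute transpose_matrix_vector)

lemma matrix_eq_0_if_inner:
  fixes P :: "real^'m^'n"
  assumes "\<And>x u. x \<bullet> (P *v u) = 0"
  shows "P = 0"
  by (metis assms inner_eq_zero_iff matrix_eq matrix_vector_mult_0)

text \<open>The equation reads \<open>A\<^sup>T P = - P A\<close>, so in the form x \<bullet> P w a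
  polynomial p(A) on the left moves to the right as p(-A). With p(A) x = 0 and p(-A) invertible the
  form vanishes.\<close>

lemma lyapunov_injective:
  fixes A :: "real^'r^'r"
  assumes h: "hurwitz_mat A" and eq: "transpose A ** P + P ** A = 0"
  shows "P = 0"
proof (rule matrix_eq_0_if_inner)
  fix x u
  have step: "(A *v x) \<bullet> (P *v w) = - (x \<bullet> (P *v (A *v w)))" for x w
  proof -
    have "x \<bullet> ((transpose A ** P + P ** A) *v w) = 0" using eq by simp
    thus ?thesis
      by (simp add: matrix_vector_mult_add_rdistrib inner_add_right inner_transpose_matvec
          flip: matrix_vector_mul_assoc)
  qed
  have shift: "poly_apply p A x \<bullet> (P *v w) = x \<bullet> (P *v poly_apply (poly_refl p) A w)" for p x w
  proof (induction p arbitrary: w)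
    case 0 show ?case by simp
  next
    case (pCons c p)
    have "poly_apply (pCons c p) A x \<bullet> (P *v w)
        = c * (x \<bullet> (P *v w)) - poly_apply p A x \<bullet> (P *v (A *v w))"
      by (simp add: inner_add_left step)
    also have "\<dots> = c * (x \<bullet> (P *v w)) - x \<bullet> (P *v (A *v poly_apply (poly_refl p) A w))"
      by (simp only: pCons.IH poly_apply_matvec)
    also have "\<dots> = x \<bullet> (P *v poly_apply (poly_refl (pCons c p)) A w)"
      by (simp add: pcompose_pCons poly_apply_add poly_apply_mult matrix_vector_right_distrib
          matrix_vector_mult_scaleR inner_add_right poly_apply_uminus matvec_uminus
          matrix_vector_mult_diff_distrib inner_diff_right)
    finally show ?case .
  qed
  obtain p where p: "p \<noteq> 0" "poly_apply p A x = 0" "hurwitz_poly p"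
    using hurwitz_annihilating_poly[OF h] by blast
  have "inj (poly_apply (poly_refl p) A)"
    using linear_injective_0[OF linear_poly_apply] hurwitz_poly_refl_apply_inj[OF h p(3,1)] by blast
  then obtain w where "u = poly_apply (poly_refl p) A w"
    using linear_injective_imp_surjective[OF linear_poly_apply] by (metis surjD)
  thus "x \<bullet> (P *v u) = 0" using shift[of p x w] p(2) by simp
qed

lemma linear_lyapunov: "linear (\<lambda>P::real^'r^'r. transpose A ** P + P ** A)"
  by (intro linearI)
     (simp_all add: vec_eq_iff matrix_matrix_mult_def sum.distrib sum_distrib_left algebra_simps)

text \<open>Existence follows from uniqueness by linearity in finite dimension. The transpose of a
  solution solves the same equation, so uniqueness also gives symmetry.\<close>

lemma lyapunov_solution:
  fixes A W :: "real^'r^'r"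
  assumes h: "hurwitz_mat A" and W: "transpose W = W"
  shows "\<exists>P. transpose P = P \<and> transpose A ** P + P ** A = W"
proof -
  let ?L = "\<lambda>P::real^'r^'r. transpose A ** P + P ** A"
  have inj: "inj ?L"
    using linear_injective_0[OF linear_lyapunov] lyapunov_injective[OF h] by blast
  have "surj ?L"
    using linear_injective_imp_surjective[OF linear_lyapunov inj] by simp
  then obtain P where P: "?L P = W" using surjD[of ?L W] by auto
  have "?L (transpose P) = transpose (?L P)"
    by (simp add: transpose_def matrix_matrix_mult_def vec_eq_iff mult.commute add.commute)
  hence "?L (transpose P) = ?L P" using P W by simp
  hence "transpose P = P" by (rule injD[OF inj])
  thus ?thesis using P by blast
qed

lemma lyapunov_kernel_trivial:
  fixes A P Q :: "real^'r^'r"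
  assumes "transpose A ** P + P ** A = - Q" "transpose P = P" "\<And>x. x \<noteq> 0 \<Longrightarrow> x \<bullet> (Q *v x) > 0"
    "P *v x = 0"
  shows "x = 0"
proof (rule ccontr)
  assume "x \<noteq> 0"
  have "x \<bullet> ((transpose A ** P + P ** A) *v x) = (A *v x) \<bullet> (P *v x) + x \<bullet> (transpose P *v (A *v x))"
    unfolding assms(2)
    by (simp add: matrix_vector_mult_add_rdistrib inner_add_right inner_transpose_matvec
        flip: matrix_vector_mul_assoc)
  also have "\<dots> = 0" unfolding inner_transpose_matvec by (simp add: assms(4))
  finally show False using assms(1) assms(3)[OF \<open>x \<noteq> 0\<close>]
    by (simp add: uminus_matvec)
qed

lemma quadratic_form_add:
  fixes P :: "real^'r^'r"
  assumes "transpose P = P"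
  shows "(x + t *\<^sub>R y) \<bullet> (P *v (x + t *\<^sub>R y)) = x \<bullet> (P *v x) + 2 * t * (y \<bullet> (P *v x)) + t\<^sup>2 * (y \<bullet> (P *v y))"
proof -
  have "x \<bullet> (P *v y) = y \<bullet> (P *v x)"
    by (metis assms inner_commute inner_transpose_matvec)
  thus ?thesis
    by (simp add: matrix_vector_right_distrib matrix_vector_mult_scaleR inner_add_left inner_add_right
        power2_eq_square algebra_simps)
qed

lemma psd_form_zero_imp_kernel:
  fixes P :: "real^'r^'r"
  assumes "transpose P = P" "\<And>x. x \<bullet> (P *v x) \<ge> 0" "x \<bullet> (P *v x) = 0"
  shows "P *v x = 0"
proof (rule ccontr)
  define y where "y = P *v x"
  assume "P *v x \<noteq> 0"
  hence y: "y \<bullet> y > 0" by (simp add: y_def)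
  define b where "b = y \<bullet> (P *v y)"
  have b: "b \<ge> 0" using assms(2) b_def by simp
  have nn: "0 \<le> 2 * t * (y \<bullet> y) + t\<^sup>2 * b" for t
    using assms(2)[of "x + t *\<^sub>R y"] unfolding quadratic_form_add[OF assms(1)] assms(3) b_def y_def by simp
  \<comment> \<open>A small step against the gradient: the linear term 2 t (y \<bullet> y) has to
    beat t^2 b. The denominator b + 1 avoids division by zero and keeps t b \<ge> - (y \<bullet>
    y).\<close>
  define t where "t = - (y \<bullet> y) / (b + 1)"
  have "t < 0" using y b by (simp add: t_def divide_neg_pos)
  hence "2 * (y \<bullet> y) + t * b \<le> 0"
  proof -
    have "0 \<le> t * (2 * (y \<bullet> y) + t * b)" using nn[of t] by (simp add: power2_eq_square algebra_simps)
    thus ?thesis using \<open>t < 0\<close> by (simp add: zero_le_mult_iff)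
  qed
  moreover have "t * b \<ge> - (y \<bullet> y)"
    using y b by (simp add: t_def field_simps)
  ultimately show False using y by linarith
qed

text \<open>An eigenvalue l of \<open>A\<close> becomes (1 - t) l - t. At t = 1 the matrix is -I and
  nothing can be divided by 1 - t, so this case is computed directly.\<close>

lemma hurwitz_mat_homotopy:
  fixes A :: "real^'r^'r"
  assumes h: "hurwitz_mat A" and t: "t \<in> {0..1}"
  shows "hurwitz_mat ((1 - t) *\<^sub>R A - t *\<^sub>R mat 1)"
  unfolding hurwitz_mat_def
proof (intro allI impI, elim conjE)
  fix \<mu> \<omega> p q
  let ?A = "(1 - t) *\<^sub>R A - t *\<^sub>R mat 1"
  assume pq: "?A *v p = \<mu> *\<^sub>R p - \<omega> *\<^sub>R q" "?A *v q = \<omega> *\<^sub>R p + \<mu> *\<^sub>R q" "p \<noteq> 0 \<or> q \<noteq> 0"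
  have A: "?A *v x = (1 - t) *\<^sub>R (A *v x) - t *\<^sub>R x" for x
    by (simp add: matrix_vector_mult_diff_rdistrib scaleR_matrix_vector_assoc[symmetric])
  have e: "(1 - t) *\<^sub>R (A *v p) = (\<mu> + t) *\<^sub>R p - \<omega> *\<^sub>R q"
       "(1 - t) *\<^sub>R (A *v q) = \<omega> *\<^sub>R p + (\<mu> + t) *\<^sub>R q"
    using pq unfolding A by (simp_all add: algebra_simps)
  show "\<mu> < 0"
  proof (cases "t = 1")
    case True
    have p: "(\<mu> + 1) *\<^sub>R p = \<omega> *\<^sub>R q" and q: "(\<mu> + 1) *\<^sub>R q = - (\<omega> *\<^sub>R p)"
      using e True by (simp_all add: eq_neg_iff_add_eq_0 add.commute)
    have "((\<mu> + 1)\<^sup>2 + \<omega>\<^sup>2) *\<^sub>R p = (\<mu> + 1) *\<^sub>R ((\<mu> + 1) *\<^sub>R p) + \<omega> *\<^sub>R (\<omega> *\<^sub>R p)"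
      by (simp add: power2_eq_square flip: scaleR_add_left)
    also have "\<dots> = \<omega> *\<^sub>R ((\<mu> + 1) *\<^sub>R q) + \<omega> *\<^sub>R (\<omega> *\<^sub>R p)" by (simp add: p mult.commute)
    also have "\<dots> = 0" by (simp add: q)
    finally have p0: "((\<mu> + 1)\<^sup>2 + \<omega>\<^sup>2) *\<^sub>R p = 0" .
    have "((\<mu> + 1)\<^sup>2 + \<omega>\<^sup>2) *\<^sub>R q = (\<mu> + 1) *\<^sub>R ((\<mu> + 1) *\<^sub>R q) + \<omega> *\<^sub>R (\<omega> *\<^sub>R q)"
      by (simp add: power2_eq_square flip: scaleR_add_left)
    also have "\<dots> = - (\<omega> *\<^sub>R ((\<mu> + 1) *\<^sub>R p)) + \<omega> *\<^sub>R (\<omega> *\<^sub>R q)" by (simp add: q mult.commute)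
    also have "\<dots> = 0" by (simp add: p)
    finally have "((\<mu> + 1)\<^sup>2 + \<omega>\<^sup>2) *\<^sub>R q = 0" .
    hence "(\<mu> + 1)\<^sup>2 + \<omega>\<^sup>2 = 0" using p0 pq(3) by auto
    thus ?thesis by (simp add: sum_power2_eq_zero_iff)
  next
    case False
    hence t1: "1 - t > 0" using t by simp
    have "A *v p = ((\<mu> + t) / (1 - t)) *\<^sub>R p - (\<omega> / (1 - t)) *\<^sub>R q"
      using arg_cong[OF e(1), of "\<lambda>x. (1 / (1 - t)) *\<^sub>R x"] t1 by (simp add: scaleR_diff_right)
    moreover have "A *v q = (\<omega> / (1 - t)) *\<^sub>R p + ((\<mu> + t) / (1 - t)) *\<^sub>R q"
      using arg_cong[OF e(2), of "\<lambda>x. (1 / (1 - t)) *\<^sub>R x"] t1 by (simp add: scaleR_add_right)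
    ultimately have "(\<mu> + t) / (1 - t) < 0" using h pq(3) unfolding hurwitz_mat_def by blast
    hence "\<mu> + t < 0" using t1 by (simp add: divide_less_0_iff)
    thus ?thesis using t by simp
  qed
qed

text \<open>The solution is deformed along \<open>A\<^sub>t = (1 - t) A - t I\<close> to \<open>Q / 2\<close>; it stays nonsingular,
  so it cannot lose definiteness on the way.\<close>

lemma lyapunov_pos_def:
  fixes A P Q :: "real^'r^'r"
  assumes h: "hurwitz_mat A" and eq: "transpose A ** P + P ** A = - Q"
    and sym: "transpose Q = Q" and Q: "\<And>x. x \<noteq> 0 \<Longrightarrow> x \<bullet> (Q *v x) > 0" and x: "x \<noteq> 0"
  shows "x \<bullet> (P *v x) > 0"
proof -
  define L where "L P = transpose A ** P + P ** A" for P
  \<comment> \<open>This is the Lyapunov operator of -I, so the segment from \<open>L\<close> to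
    \<open>M\<close> consists of the Lyapunov operators of the matrices \<open>H t\<close>.\<close>
  define M :: "real^'r^'r \<Rightarrow> real^'r^'r" where "M P = - P - P" for P
  define H where "H t = (1 - t) *\<^sub>R A - t *\<^sub>R mat 1" for t :: real
  have HL: "transpose (H t) ** R + R ** H t = (1 - t) *\<^sub>R L R + t *\<^sub>R M R" for t R
  proof -
    have T: "transpose (H t) = (1 - t) *\<^sub>R transpose A - t *\<^sub>R mat 1"
      by (simp add: H_def vec_eq_iff transpose_def mat_def)
    show ?thesis unfolding T unfolding matrix_eq H_def L_def M_def
      by (simp add: matrix_vector_mult_add_rdistrib matrix_vector_mult_diff_rdistrib
          matrix_vector_mult_diff_distrib matrix_vector_mult_scaleR uminus_matvec
          scaleR_diff_left scaleR_add_right scaleR_diff_right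
          flip: matrix_vector_mul_assoc scaleR_matrix_vector_assoc)
         (simp add: vec_eq_iff matrix_vector_mult_def sum_distrib_left mult.assoc)
  qed
  have Hh: "hurwitz_mat (H t)" if "t \<in> {0..1}" for t
    unfolding H_def using hurwitz_mat_homotopy[OF h that] .
  have "linear L" unfolding L_def by (rule linear_lyapunov)
  moreover have "linear M" unfolding M_def by (intro linear_compose_sub linear_compose_neg linear_ident)
  moreover have "R = 0" if "t \<in> {0..1}" "(1 - t) *\<^sub>R L R + t *\<^sub>R M R = 0" for t R
    using lyapunov_injective[OF Hh[OF that(1)]] that(2) unfolding HL by blast
  ultimately obtain X where X: "continuous_on {0..1::real} X"
      "\<And>t. t \<in> {0..1} \<Longrightarrow> (1 - t) *\<^sub>R L (X t) + t *\<^sub>R M (X t) = - Q"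
    using linear_homotopy_solution[of L M "- Q"] by blast
  have Xeq: "transpose (H t) ** X t + X t ** H t = - Q" if "t \<in> {0..1}" for t
    using X(2)[OF that] HL by simp
  have uniq: "R = S" if "t \<in> {0..1}" "transpose (H t) ** R + R ** H t = - Q"
      "transpose (H t) ** S + S ** H t = - Q" for t R S
  proof -
    have "transpose (H t) ** (R - S) + (R - S) ** H t = 0"
      using that(2,3) linear_diff[OF linear_lyapunov, of "H t" R S] by simp
    hence "R - S = 0" by (rule lyapunov_injective[OF Hh[OF that(1)]])
    thus ?thesis by simp
  qed
  have Xsym: "transpose (X t) = X t" if t: "t \<in> {0..1}" for t
  proof -
    have "transpose (- Q) = - Q" using sym by (simp add: transpose_def vec_eq_iff)
    then obtain S where "transpose S = S" "transpose (H t) ** S + S ** H t = - Q"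
      using lyapunov_solution[OF Hh[OF t]] by blast
    moreover from this have "S = X t" by (intro uniq[OF t _ Xeq[OF t]])
    ultimately show ?thesis by simp
  qed
  have ker: "y = 0" if "t \<in> {0..1}" "X t *v y = 0" for t y
    using lyapunov_kernel_trivial[OF Xeq[OF that(1)] Xsym[OF that(1)] Q that(2)] by blast
  define f where "f z = snd z \<bullet> (X (fst z) *v snd z)" for z :: "real \<times> (real^'r)"
  have cf: "continuous_on ({0..1} \<times> UNIV) f"
  proof -
    have "continuous_on ({0..1} \<times> UNIV) (\<lambda>z::real \<times> (real^'r). X (fst z))"
      by (rule continuous_on_compose2[OF X(1)]) (auto intro: continuous_intros)
    thus ?thesis unfolding f_def matrix_vector_mult_def by (intro continuous_intros)
  qed
  define S where "S = sphere (0::real^'r) 1"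
  \<comment> \<open>\<open>T0\<close> collects the t at which the form is nonpositive at some unit
    vector, \<open>T1\<close> those at which it is semidefinite. Both are closed and together they
    cover [0,1]; a common point would give \<open>X t\<close> a kernel. As 1 lies in
    \<open>T1\<close>, connectedness empties \<open>T0\<close>.\<close>
  define T0 where "T0 = fst ` ({0..1} \<times> S \<inter> f -` {..0})"
  define T1 where "T1 = {0..1::real} \<inter> (\<Inter>y. {t. y \<bullet> (X t *v y) \<ge> 0})"
  have cS: "compact ({0..1::real} \<times> S)" unfolding S_def by (intro compact_Times) auto
  have "closed ({0..1} \<times> S \<inter> f -` {..0})"
    by (intro continuous_closed_preimage[OF continuous_on_subset[OF cf] compact_imp_closed[OF cS]]) auto
  hence "compact ({0..1} \<times> S \<inter> f -` {..0})"
    using cS by (metis Int_assoc Int_absorb compact_Int_closed)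
  hence "closed T0"
    unfolding T0_def by (intro compact_imp_closed compact_continuous_image continuous_intros)
  have "T1 = (\<Inter>y. {0..1::real} \<inter> (\<lambda>t. f (t, y)) -` {0..})"
    by (auto simp: T1_def f_def)
  moreover have "closed ({0..1::real} \<inter> (\<lambda>t. f (t, y)) -` {0..})" for y
    by (intro continuous_closed_preimage continuous_on_compose2[OF cf]) (auto intro!: continuous_intros)
  ultimately have "closed T1" by (simp only: closed_INT ball_simps simp_thms)
  have scale: "y \<bullet> (R *v y) = (norm y)\<^sup>2 * ((y /\<^sub>R norm y) \<bullet> (R *v (y /\<^sub>R norm y)))"
    if "y \<noteq> 0" for y and R :: "real^'r^'r"
    using that by (simp add: matrix_vector_mult_scaleR power2_eq_square field_simps)
  have pd: "y \<bullet> (X t *v y) > 0" if "t \<in> {0..1}" "t \<notin> T0" "y \<noteq> 0" for t y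
  proof -
    have "(t, y /\<^sub>R norm y) \<in> {0..1} \<times> S" using that by (simp add: S_def)
    moreover have "(t, y /\<^sub>R norm y) \<notin> {0..1} \<times> S \<inter> f -` {..0}"
      using that(2) unfolding T0_def by (metis fst_conv image_eqI)
    ultimately have "f (t, y /\<^sub>R norm y) > 0" by auto
    hence "(norm y)\<^sup>2 * f (t, y /\<^sub>R norm y) > 0" using that(3) by simp
    thus ?thesis unfolding scale[OF that(3), of "X t"] f_def by simp
  qed
  have "T0 \<inter> T1 \<inter> {0..1} = {}"
  proof (rule ccontr)
    assume "T0 \<inter> T1 \<inter> {0..1} \<noteq> {}"
    then obtain t where t: "t \<in> T0" "t \<in> T1" "t \<in> {0..1}" by blast
    then obtain y where y: "y \<in> S" "y \<bullet> (X t *v y) \<le> 0" by (auto simp: T0_def f_def)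
    have nn: "\<And>y. y \<bullet> (X t *v y) \<ge> 0" using t(2) by (auto simp: T1_def)
    hence "y \<bullet> (X t *v y) = 0" using y(2) by (intro order.antisym)
    hence "X t *v y = 0" using psd_form_zero_imp_kernel[OF Xsym[OF t(3)] nn] by blast
    hence "y = 0" using ker t(3) by blast
    thus False using y(1) by (simp add: S_def)
  qed
  moreover have "{0..1} \<subseteq> T0 \<union> T1"
  proof
    fix t :: real assume t: "t \<in> {0..1}"
    have "t \<in> T1" if "t \<notin> T0"
    proof -
      have "y \<bullet> (X t *v y) \<ge> 0" for y
        using pd[OF t that, of y] by (cases "y = 0") auto
      thus ?thesis using t by (simp add: T1_def)
    qed
    thus "t \<in> T0 \<union> T1" by blast
  qed
  moreover have "1 \<in> T1"
  proof -
    have "X 1 = (1/2) *\<^sub>R Q" using X(2)[of 1] by (simp add: M_def vec_eq_iff field_simps)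
    moreover have "y \<bullet> (Q *v y) \<ge> 0" for y using Q[of y] by (cases "y = 0") auto
    ultimately show ?thesis by (simp add: T1_def scaleR_matrix_vector_assoc[symmetric])
  qed
  ultimately have "T0 \<inter> {0..1} = {}"
    using \<open>closed T0\<close> \<open>closed T1\<close> connected_closedD[OF connected_Icc, of T0 T1 0 1] by auto
  hence "0 \<notin> T0" by auto
  moreover have "X 0 = P"
    by (rule uniq[of 0]) (use Xeq[of 0] eq in \<open>auto simp: H_def\<close>)
  ultimately show ?thesis using pd[of 0 x] x by simp
qed

section \<open>Resolvent polynomials and the common Lyapunov matrix\<close>

text \<open>Vector polynomials are kept as families of scalar ones, so that degree and coefficient
  arguments apply to each entry and to linear combinations of entries.\<close>

definition vpoly :: "('r::finite \<Rightarrow> real poly) \<Rightarrow> real \<Rightarrow> real^'r" where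
  "vpoly U s = (\<chi> i. poly (U i) s)"

definition poly_comb :: "real^'r \<Rightarrow> ('r::finite \<Rightarrow> real poly) \<Rightarrow> real poly" where
  "poly_comb m U = (\<Sum>i\<in>UNIV. smult (m $ i) (U i))"

lemma poly_poly_comb [simp]: "poly (poly_comb m U) s = m \<bullet> vpoly U s"
  by (simp add: poly_comb_def vpoly_def poly_sum inner_vec_def)

lemma vpoly_nth [simp]: "vpoly U s $ i = poly (U i) s"
  by (simp add: vpoly_def)

lemma poly_comb_add: "poly_comb (m + n) U = poly_comb m U + poly_comb n U"
  by (rule poly_eqI_fun) (simp add: inner_add_left)

lemma poly_comb_scaleR: "poly_comb (c *\<^sub>R m) U = smult c (poly_comb m U)"
  by (rule poly_eqI_fun) simp

lemma outer_matvec: "outer g h *v x = (h \<bullet> x) *\<^sub>R (g :: real^'r)"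
  by (simp add: outer_def vec_eq_iff matrix_vector_mult_def inner_vec_def sum_distrib_left mult_ac)

lemma poly_char_poly: "poly (char_poly M) s = det (s *\<^sub>R mat 1 - M)"
  unfolding char_poly_def det_def
  by (auto simp: poly_sum poly_prod of_int_poly mat_def intro!: sum.cong prod.cong)

lemma det_nonzero_kernel:
  fixes M :: "real^'r^'r"
  assumes "det M \<noteq> 0" "M *v x = 0"
  shows "x = 0"
  using assms by (metis invertible_det_nz invertible_left_inverse matrix_left_invertible_ker)

lemma det_zero_kernel:
  fixes M :: "real^'r^'r"
  assumes "det M = 0"
  shows "\<exists>x. x \<noteq> 0 \<and> M *v x = 0"
  using assms by (metis invertible_det_nz invertible_left_inverse matrix_left_invertible_ker)

lemma det_scale_column:
  fixes M :: "real^'r^'r"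
  shows "det (\<chi> i j. if j = k then c * b $ i else M $ i $ j) = c * det (\<chi> i j. if j = k then b $ i else M $ i $ j)"
proof -
  have "det (\<chi> i j. if j = k then c * b $ i else M $ i $ j)
      = det (\<chi> j. if j = k then c *s b else (\<chi> i. M $ i $ j))"
    by (subst det_transpose[symmetric]) (rule arg_cong[of _ _ det], simp add: transpose_def vec_eq_iff)
  also have "\<dots> = c * det (\<chi> j. if j = k then b else (\<chi> i. M $ i $ j))"
    by (rule det_row_mul)
  also have "det (\<chi> j. if j = k then b else (\<chi> i. M $ i $ j)) = det (\<chi> i j. if j = k then b $ i else M $ i $ j)"
    by (subst det_transpose[symmetric]) (rule arg_cong[of _ _ det], simp add: transpose_def vec_eq_iff)
  finally show ?thesis .
qed

lemma continuous_det [continuous_intros]: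
  fixes f :: "real \<Rightarrow> real^'r^'r"
  assumes "\<And>i j. continuous F (\<lambda>s. f s $ i $ j)"
  shows "continuous F (\<lambda>s. det (f s))"
  unfolding det_def by (intro continuous_intros assms)

lemma coeff_mult_eq_0:
  fixes p q :: "real poly"
  assumes "\<And>k. k \<ge> m \<Longrightarrow> coeff p k = 0" "\<And>k. k > n \<Longrightarrow> coeff q k = 0" "k \<ge> m + n"
  shows "coeff (p * q) k = 0"
  unfolding coeff_mult
proof (intro sum.neutral ballI)
  fix i assume "i \<in> {..k}"
  thus "coeff p i * coeff q (k - i) = 0"
    using assms(1)[of i] assms(2)[of "k - i"] assms(3) by (cases "i \<ge> m") auto
qed

lemma degree_poly_refl [simp]: "degree (poly_refl p) = degree p"
  by (simp add: degree_pcompose)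

lemma coeff_poly_refl: "coeff (poly_refl p) k = (-1) ^ k * coeff p k"
  by (rule coeff_pcompose_linear)

lemma coeff_mult_poly_refl_top:
  fixes p :: "real poly"
  assumes "degree p \<le> n"
  shows "coeff (p * poly_refl p) (2 * n) = (-1) ^ n * (coeff p n)\<^sup>2"
proof (cases "degree p = n")
  case True
  have "coeff (p * poly_refl p) (degree p + degree (poly_refl p)) = lead_coeff p * lead_coeff (poly_refl p)"
    by (rule coeff_mult_degree_sum)
  thus ?thesis using True by (simp add: coeff_poly_refl power2_eq_square mult_2)
next
  case False
  hence "degree p < n" using assms by simp
  hence "coeff (p * poly_refl p) (2 * n) = 0"
    by (intro coeff_mult_eq_0[of n _ n]) (auto intro: coeff_eq_0)
  thus ?thesis using \<open>degree p < n\<close> by (simp add: coeff_eq_0)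
qed

lemma poly_negsq_degree_lead:
  assumes "R = poly_negsq \<rho>" "\<And>k. k > 2 * r \<Longrightarrow> coeff R k = 0" "coeff R (2 * r) = c * (-1) ^ r" "c \<noteq> 0"
  shows "degree \<rho> = r" "lead_coeff \<rho> = c"
proof -
  have "coeff R (2 * r) \<noteq> 0" using assms by simp
  hence d: "degree R = 2 * r"
    using assms(2) by (intro order.antisym degree_le le_degree) auto
  thus r: "degree \<rho> = r" using assms(1) by (simp add: degree_pcompose)
  have "lead_coeff R = lead_coeff \<rho> * (-1) ^ degree \<rho>"
    unfolding assms(1) by (subst lead_coeff_comp) auto
  thus "lead_coeff \<rho> = c" using d r assms(3) by simp
qed

text \<open>Division of p(s) I - p(A) by s I - A, applied to \<open>g\<close>; the step w + s U is
  Horner's scheme.\<close>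

lemma resolvent_poly_exists:
  fixes A :: "real^'r^'r"
  shows "\<exists>U. (\<forall>i k. k \<ge> degree p \<longrightarrow> coeff (U i) k = 0) \<and>
    (\<forall>s. s *\<^sub>R vpoly U s - A *v vpoly U s = poly p s *\<^sub>R g - poly_apply p A g)"
proof (induction p)
  case 0
  show ?case by (intro exI[of _ "\<lambda>_. 0"]) (simp add: vpoly_def flip: zero_vec_def)
next
  case (pCons c p)
  then obtain U where U: "\<And>i k. k \<ge> degree p \<Longrightarrow> coeff (U i) k = 0"
     "\<And>s. s *\<^sub>R vpoly U s - A *v vpoly U s = poly p s *\<^sub>R g - poly_apply p A g" by blast
  define w where "w = poly_apply p A g"
  define V where "V i = pCons (w $ i) (U i)" for i
  have V: "vpoly V s = w + s *\<^sub>R vpoly U s" for s by (simp add: V_def vec_eq_iff)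
  have "s *\<^sub>R vpoly V s - A *v vpoly V s = poly (pCons c p) s *\<^sub>R g - poly_apply (pCons c p) A g" for s
  proof -
    have "s *\<^sub>R vpoly V s - A *v vpoly V s
        = s *\<^sub>R (s *\<^sub>R vpoly U s - A *v vpoly U s) + s *\<^sub>R w - A *v w"
      unfolding V by (simp add: algebra_simps matrix_vector_right_distrib matrix_vector_mult_scaleR)
    also have "\<dots> = poly (pCons c p) s *\<^sub>R g - poly_apply (pCons c p) A g"
      unfolding U(2) w_def by (simp add: algebra_simps)
    finally show ?thesis .
  qed
  moreover have "coeff (V i) k = 0" if "k \<ge> degree (pCons c p)" for i k
  proof (cases "p = 0")
    case True
    have "coeff (U i) k = 0" for k using U(1) True by simp
    thus ?thesis by (simp add: V_def w_def True coeff_pCons split: nat.splits)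
  next
    case False
    hence "k \<ge> Suc (degree p)" using that by simp
    then obtain k' where "k = Suc k'" "k' \<ge> degree p" by (cases k) auto
    thus ?thesis using U(1) by (simp add: V_def)
  qed
  ultimately show ?case by blast
qed

text \<open>Since a(A) g = 0, the division leaves no remainder and U(s) = a(s) (s I - A)^-1 g. Thus
  h \<bullet> U(s) is the numerator of H over the denominator \<open>a\<close>.\<close>

locale krylov_resolvent =
  fixes A :: "real^'r^'r" and g :: "real^'r" and a :: "real poly" and U :: "'r \<Rightarrow> real poly"
  assumes hurwitz: "hurwitz_mat A" and ctrb: "controllable A g"
    and deg_a: "degree a = CARD('r)" and lead_a: "lead_coeff a = 1"
    and annihil: "poly_apply a A g = 0"
    and resolvent: "\<And>s. A *v vpoly U s = s *\<^sub>R vpoly U s - poly a s *\<^sub>R g"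
    and coeff_U: "\<And>i k. k \<ge> CARD('r) \<Longrightarrow> coeff (U i) k = 0"
begin

lemma a_nonzero: "a \<noteq> 0"
  using lead_a by auto

lemma hurwitz_a: "hurwitz_poly a"
  by (rule minimal_poly_hurwitz[OF hurwitz a_nonzero annihil])
     (use krylov_independent[OF ctrb] deg_a in auto)

lemma a_at_0: "poly a 0 \<noteq> 0"
proof
  assume "poly a 0 = 0"
  hence "root_factor 0 0 dvd a" by (simp add: root_factor_def poly_eq_0_iff_dvd)
  thus False using hurwitz_a unfolding hurwitz_poly_def by blast
qed

lemma A_injective: "A *v x = 0 \<Longrightarrow> x = 0"
  using hurwitz unfolding hurwitz_mat_def
  by (metis add.right_neutral diff_0_right less_irrefl matrix_vector_mult_0_right scaleR_zero_left)

lemma coeff_comb: "k \<ge> CARD('r) \<Longrightarrow> coeff (poly_comb m U) k = 0"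
  by (simp add: poly_comb_def coeff_sum coeff_U)

lemma degree_comb: "degree (poly_comb m U) < CARD('r)"
  by (rule degree_lessI) (auto simp: coeff_comb)

text \<open>If m \<bullet> U vanishes, then (A^T m) \<bullet> U = - (m \<bullet> g) a. The left side
  has degree below r, the right side degree r unless m \<bullet> g = 0. Repeating this with A^T m
  shows that m is orthogonal to every Krylov vector.\<close>

lemma comb_injective:
  assumes "poly_comb m U = 0"
  shows "m = 0"
proof -
  have step: "m \<bullet> g = 0 \<and> poly_comb (transpose A *v m) U = 0" if "poly_comb m U = 0" for m
  proof -
    have e: "poly_comb (transpose A *v m) U = smult (- (m \<bullet> g)) a"
    proof (rule poly_eqI_fun)
      fix s
      have "m \<bullet> vpoly U s = 0" using that poly_poly_comb[of m U s] by simp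
      moreover have "(transpose A *v m) \<bullet> vpoly U s = m \<bullet> (A *v vpoly U s)"
        by (metis inner_commute inner_transpose_matvec)
      ultimately show "poly (poly_comb (transpose A *v m) U) s = poly (smult (- (m \<bullet> g)) a) s"
        by (simp add: resolvent inner_diff_right)
    qed
    hence "coeff (poly_comb (transpose A *v m) U) (CARD('r)) = - (m \<bullet> g)"
      using lead_a deg_a by simp
    hence "m \<bullet> g = 0" using coeff_comb by simp
    thus ?thesis using e by simp
  qed
  have "m \<bullet> (matpow A k *v g) = 0" for k
    using assms
  proof (induction k arbitrary: m)
    case 0
    thus ?case using step by (simp add: matpow_def)
  next
    case (Suc k)
    hence "(transpose A *v m) \<bullet> (matpow A k *v g) = 0" using step by blast
    moreover have "matpow A (Suc k) *v g = A *v (matpow A k *v g)"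
      by (simp add: matpow_def matrix_vector_mul_assoc)
    ultimately show ?case
      using inner_transpose_matvec[of "matpow A k *v g" A m] by (simp add: inner_commute)
  qed
  hence "\<And>x. x \<in> {matpow A k *v g | k. k < CARD('r)} \<Longrightarrow> orthogonal m x"
    by (auto simp: orthogonal_def)
  hence "orthogonal m m"
    using orthogonal_to_span[of m "{matpow A k *v g | k. k < CARD('r)}" m] ctrb
    by (auto simp: controllable_def)
  thus ?thesis by (simp add: orthogonal_def)
qed

text \<open>By injectivity and dimension, every polynomial of degree below r is m \<bullet> U for
  some m. This is how a spectral factor is turned into a vector.\<close>

lemma comb_surjective:
  assumes "\<And>k. k \<ge> CARD('r) \<Longrightarrow> coeff p k = 0"
  shows "\<exists>m. poly_comb m U = p"
proof -
  obtain e where e: "bij_betw e (UNIV :: 'r set) {..<CARD('r)}"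
    using finite_index_bij by blast
  define f :: "real^'r \<Rightarrow> real^'r" where "f m = (\<chi> i. coeff (poly_comb m U) (e i))" for m
  have lin: "linear f"
    unfolding f_def by (intro linearI) (simp_all add: vec_eq_iff poly_comb_add poly_comb_scaleR)
  have agree: "P = Q" if "\<And>i. coeff P (e i) = coeff Q (e i)"
      "\<And>k. k \<ge> CARD('r) \<Longrightarrow> coeff P k = 0" "\<And>k. k \<ge> CARD('r) \<Longrightarrow> coeff Q k = 0" for P Q :: "real poly"
  proof (rule poly_eqI)
    fix k
    show "coeff P k = coeff Q k"
    proof (cases "k < CARD('r)")
      case True
      then obtain i where "e i = k" using e by (metis (no_types, lifting) bij_betw_def imageE lessThan_iff)
      thus ?thesis using that(1) by blast
    qed (use that in simp)
  qed
  have "inj f"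
  proof (rule linear_injective_0[OF lin, THEN iffD2], intro allI impI)
    fix m assume "f m = 0"
    hence "poly_comb m U = 0" by (intro agree) (auto simp: f_def vec_eq_iff coeff_comb)
    thus "m = 0" by (rule comb_injective)
  qed
  hence "surj f" using linear_injective_imp_surjective[OF lin] by simp
  then obtain m where "f m = (\<chi> i. coeff p (e i))" by (metis surjD)
  hence "poly_comb m U = p" by (intro agree) (auto simp: f_def vec_eq_iff coeff_comb assms)
  thus ?thesis by blast
qed

text \<open>With \<open>H(s) = h\<^sup>T (sI - A)\<^sup>-\<^sup>1 g\<close>, the polynomial \<open>popov h\<close> takes the value
  \<open>2 |a(i\<omega>)|\<^sup>2 (1 + Re H(i\<omega>))\<close> on the imaginary axis.\<close>

definition popov :: "real^'r \<Rightarrow> real poly" where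
  "popov h = smult 2 (a * poly_refl a) + poly_refl a * poly_comb h U + a * poly_refl (poly_comb h U)"

lemma popov_even: "poly_refl (popov h) = popov h"
  by (simp add: popov_def pcompose_add pcompose_mult pcompose_smult mult.commute add_ac)

lemma poly_popov:
  "poly (popov h) s = 2 * poly a s * poly a (-s) + poly a (-s) * (h \<bullet> vpoly U s) + poly a s * (h \<bullet> vpoly U (-s))"
  by (simp add: popov_def poly_pcompose)

lemma coeff_popov_top:
  shows "coeff (popov h) (2 * CARD('r)) = 2 * (-1) ^ CARD('r)"
    and "k > 2 * CARD('r) \<Longrightarrow> coeff (popov h) k = 0"
proof -
  let ?r = "CARD('r)"
  have za: "coeff a k = 0" if "k > ?r" for k using that deg_a by (simp add: coeff_eq_0)
  have z: "coeff (poly_refl a * poly_comb h U) k = 0" "coeff (a * poly_refl (poly_comb h U)) k = 0" if "k \<ge> 2 * ?r" for k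
    using that coeff_mult_eq_0[of ?r "poly_comb h U" ?r "poly_refl a" k]
      coeff_mult_eq_0[of ?r "poly_refl (poly_comb h U)" ?r a k]
    by (auto simp: coeff_comb za coeff_poly_refl mult.commute)
  show "coeff (popov h) (2 * ?r) = 2 * (-1) ^ ?r"
    using coeff_mult_poly_refl_top[of a ?r] z[of "2 * ?r"] lead_a deg_a by (simp add: popov_def)
  show "coeff (popov h) k = 0" if "k > 2 * ?r"
    using z[of k] that deg_a by (simp add: popov_def coeff_eq_0 degree_mult_eq a_nonzero pcompose_eq_0_iff)
qed

text \<open>\<open>Y\<close> is even in s; on the imaginary axis it is 2 |a|^2 times the real part
  of (s I - A)^-1 g. Its odd companion \<open>Z\<close> satisfies A Z = s Y and A Y = s Z up to a
  multiple of \<open>g\<close>. Where \<open>popov h\<close> vanishes, \<open>Y s\<close> is in the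
  eigenspace of \<open>A ** B\<close> for s^2.\<close>

lemma popov_matrix_identity:
  assumes B: "B = A - outer g h"
  defines "Y \<equiv> \<lambda>s. poly a (-s) *\<^sub>R vpoly U s + poly a s *\<^sub>R vpoly U (-s)"
  shows "A *v (B *v Y s) = s\<^sup>2 *\<^sub>R Y s - poly (popov h) s *\<^sub>R (A *v g)"
proof -
  define Z where "Z = poly a (-s) *\<^sub>R vpoly U s - poly a s *\<^sub>R vpoly U (-s)"
  have AY: "A *v Y s = s *\<^sub>R Z - (2 * poly a s * poly a (-s)) *\<^sub>R g"
    unfolding Y_def Z_def matrix_vector_right_distrib matrix_vector_mult_scaleR resolvent
    by (simp add: vec_eq_iff algebra_simps)
  have AZ: "A *v Z = s *\<^sub>R Y s"
    unfolding Y_def Z_def matrix_vector_mult_diff_distrib matrix_vector_mult_scaleR resolvent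
    by (simp add: vec_eq_iff algebra_simps)
  have hY: "h \<bullet> Y s = poly (popov h) s - 2 * poly a s * poly a (-s)"
    by (simp add: Y_def poly_popov inner_add_right)
  have "B *v Y s = A *v Y s - (h \<bullet> Y s) *\<^sub>R g"
    by (simp add: B matrix_vector_mult_diff_rdistrib outer_matvec)
  also have "\<dots> = s *\<^sub>R Z - poly (popov h) s *\<^sub>R g"
    unfolding AY hY by (simp add: vec_eq_iff algebra_simps)
  finally show ?thesis
    by (simp add: matrix_vector_mult_diff_distrib matrix_vector_mult_scaleR AZ power2_eq_square)
qed

end

lemma krylov_resolvent_exists:
  fixes A :: "real^'r^'r"
  assumes "hurwitz_mat A" "controllable A g"
  shows "\<exists>a U. krylov_resolvent A g a U"
proof -
  obtain a where a: "degree a = CARD('r)" "lead_coeff a = 1" "poly_apply a A g = 0"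
    using krylov_char_poly[OF assms(2)] by blast
  obtain U where U: "\<And>i k. k \<ge> degree a \<Longrightarrow> coeff (U i) k = 0"
    "\<And>s. s *\<^sub>R vpoly U s - A *v vpoly U s = poly a s *\<^sub>R g - poly_apply a A g"
    using resolvent_poly_exists[of a A g] by blast
  have "A *v vpoly U s = s *\<^sub>R vpoly U s - poly a s *\<^sub>R g" for s
    using U(2)[of s] a(3) by (simp add: algebra_simps)
  hence "krylov_resolvent A g a U" using assms a U(1) by unfold_locales auto
  thus ?thesis by blast
qed

context krylov_resolvent
begin

lemma vpoly_at_0:
  assumes "A *v v = g"
  shows "vpoly U 0 = - (poly a 0 *\<^sub>R v)"
proof -
  have "A *v (vpoly U 0 + poly a 0 *\<^sub>R v) = 0"
    by (simp add: matrix_vector_right_distrib matrix_vector_mult_scaleR resolvent assms)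
  thus ?thesis using A_injective by (metis add_eq_0_iff2)
qed

text \<open>In the variable z = -s^2 a zero of \<open>popov h\<close> at z > 0 would make -z an
  eigenvalue of \<open>A ** B\<close>. At z = 0 a zero exists because h \<bullet> v = 1, and it is
  simple because the zero eigenvalue is.\<close>

lemma popov_factor:
  fixes h :: "real^'r" and B :: "real^'r^'r"
  assumes B: "B = A - outer g h"
    and noneg: "\<forall>s::real. s < 0 \<longrightarrow> poly (char_poly (A ** B)) s \<noteq> 0"
    and zero1: "order 0 (char_poly (A ** B)) = 1"
    and v: "A *v v = g" "h \<bullet> v = 1"
  shows "\<exists>\<rho>. popov h = poly_negsq (pCons 0 \<rho>) \<and> degree \<rho> = CARD('r) - 1 \<and> (\<forall>z\<ge>0. poly \<rho> z > 0)"
proof -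
  let ?r = "CARD('r)"
  note U0 = vpoly_at_0[OF v(1)]
  obtain \<rho>0 where \<rho>0: "popov h = poly_negsq \<rho>0" using even_poly_is_negsq[OF popov_even] by blast
  have \<rho>0_at: "poly (popov h) s = poly \<rho>0 (- s\<^sup>2)" for s
    by (simp add: \<rho>0 poly_pcompose power2_eq_square)
  have deg0: "degree \<rho>0 = ?r" "lead_coeff \<rho>0 = 2"
    using poly_negsq_degree_lead[OF \<rho>0 coeff_popov_top(2) coeff_popov_top(1)] by auto
  have "poly \<rho>0 0 = 0"
    using \<rho>0_at[of 0] v by (simp add: poly_popov U0)
  then obtain \<rho> where \<rho>: "\<rho>0 = pCons 0 \<rho>"
    by (cases \<rho>0) auto
  have "\<rho>0 \<noteq> 0" using deg0 by auto
  hence \<rho>n0: "\<rho> \<noteq> 0" using \<rho> by auto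
  have sd: "degree \<rho>0 = Suc (degree \<rho>)" "lead_coeff \<rho>0 = lead_coeff \<rho>"
    using \<rho>n0 by (simp_all add: \<rho>)
  have deg: "degree \<rho> = ?r - 1" "lead_coeff \<rho> = 2"
    using deg0 unfolding sd(2) unfolding sd(1) by simp_all
  obtain \<alpha> where \<alpha>: "a * poly_refl a = poly_negsq \<alpha>" "\<And>z. z \<ge> 0 \<Longrightarrow> poly \<alpha> z > 0"
    using hurwitz_poly_norm_imaginary_axis[OF hurwitz_a a_nonzero] by blast
  have \<alpha>_at: "poly a s * poly a (-s) = poly \<alpha> (- s\<^sup>2)" for s
    using arg_cong[OF \<alpha>(1), of "\<lambda>p. poly p s"] by (simp add: poly_pcompose power2_eq_square)
  define Yp where "Yp i = poly_refl a * U i + a * poly_refl (U i)" for i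
  have Y: "vpoly Yp s = poly a (-s) *\<^sub>R vpoly U s + poly a s *\<^sub>R vpoly U (-s)" for s
    by (simp add: vec_eq_iff Yp_def poly_pcompose)
  have "\<exists>y. Yp i = poly_negsq y" for i
    by (rule even_poly_is_negsq) (simp add: Yp_def pcompose_add pcompose_mult mult.commute add.commute)
  then obtain y where y: "\<And>i. Yp i = poly_negsq (y i)" by metis
  have y_at: "vpoly Yp s = vpoly y (- s\<^sup>2)" for s
    by (simp add: vec_eq_iff y poly_pcompose power2_eq_square)
  have id_s: "(A ** B) *v vpoly Yp s = s\<^sup>2 *\<^sub>R vpoly Yp s - poly (popov h) s *\<^sub>R (A *v g)" for s
    using popov_matrix_identity[OF B, of s] unfolding Y[symmetric] by (simp add: matrix_vector_mul_assoc)
  \<comment> \<open>For real s only z = -s^2 \<le> 0 is reached, whereas the frequencies are z > 0;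
    the identity is carried over as one between polynomials in z.\<close>
  have id_z: "(A ** B) *v vpoly y z = - (z *\<^sub>R vpoly y z) - poly \<rho>0 z *\<^sub>R (A *v g)" for z
  proof -
    have "poly_comb ((A ** B) $ i) y = - ([:0, 1:] * y i) - smult ((A *v g) $ i) \<rho>0" for i
    proof (rule poly_eq_if_agree_at_squares)
      fix s
      show "poly (poly_comb ((A ** B) $ i) y) (- s\<^sup>2) = poly (- ([:0, 1:] * y i) - smult ((A *v g) $ i) \<rho>0) (- s\<^sup>2)"
        using arg_cong[OF id_s[of s], of "\<lambda>x. x $ i"] unfolding y_at \<rho>0_at
        by (simp add: matrix_vector_mul_component mult.commute)
    qed
    hence "((A ** B) $ i) \<bullet> vpoly y z = poly (- ([:0, 1:] * y i) - smult ((A *v g) $ i) \<rho>0) z" for i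
      by (metis poly_poly_comb)
    thus ?thesis by (simp add: vec_eq_iff matrix_vector_mul_component mult.commute)
  qed
  have h_z: "h \<bullet> vpoly y z = poly \<rho>0 z - 2 * poly \<alpha> z" for z
  proof -
    have "poly_comb h y = \<rho>0 - smult 2 \<alpha>"
    proof (rule poly_eq_if_agree_at_squares)
      fix s
      have "h \<bullet> vpoly Yp s = poly (popov h) s - 2 * (poly a s * poly a (-s))"
        by (simp add: Y poly_popov inner_add_right)
      thus "poly (poly_comb h y) (- s\<^sup>2) = poly (\<rho>0 - smult 2 \<alpha>) (- s\<^sup>2)"
        unfolding y_at \<rho>0_at \<alpha>_at by simp
    qed
    thus ?thesis by (metis poly_poly_comb poly_diff poly_smult)
  qed
  \<comment> \<open>At a zero, \<open>vpoly y z\<close> lies in the kernel of -z I - A B, hence is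
    0. But then \<open>h_z\<close> gives \<alpha>(z) = 0, against the positivity of |a|^2.\<close>
  have nz_pos: "poly \<rho> z \<noteq> 0" if "z > 0" for z
  proof
    assume "poly \<rho> z = 0"
    hence r0: "poly \<rho>0 z = 0" by (simp add: \<rho>)
    have "((- z) *\<^sub>R mat 1 - A ** B) *v vpoly y z = 0"
      using id_z[of z] r0
      by (simp add: matrix_vector_mult_diff_rdistrib uminus_matvec flip: scaleR_matrix_vector_assoc)
    moreover have "det ((- z) *\<^sub>R mat 1 - A ** B) \<noteq> 0"
      unfolding poly_char_poly[symmetric] using noneg that by simp
    ultimately have "vpoly y z = 0" by (metis det_nonzero_kernel)
    hence "poly \<alpha> z = 0" using h_z[of z] r0 by simp
    thus False using \<alpha>(2)[of z] that by simp
  qed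
  \<comment> \<open>Cramer's rule for entry \<open>k\<close> compares the characteristic polynomial
    s^2 f(s^2) with \<open>popov h\<close>, which is -s^2 \<rho>(-s^2). After cancelling s^2 and
    letting s tend to 0, \<rho>(0) = 0 would give f(0) Y_k(0) = 0, although f(0) \<noteq> 0 and Y(0)
    is a nonzero multiple of \<open>v\<close>.\<close>
  have nz_0: "poly \<rho> 0 \<noteq> 0"
  proof
    assume r0: "poly \<rho> 0 = 0"
    have "v \<noteq> 0" using v by auto
    then obtain k where k: "v $ k \<noteq> 0" by (auto simp: vec_eq_iff)
    define b where "b = A *v g"
    define D where "D s = det (\<chi> i j. if j = k then b $ i else (s\<^sup>2 *\<^sub>R mat 1 - A ** B) $ i $ j)" for s :: real
    have cp0: "char_poly (A ** B) \<noteq> 0" using noneg by (metis neg_less_0_iff_less poly_0 zero_less_one)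
    obtain f where f: "char_poly (A ** B) = [:0, 1:] * f" "poly f 0 \<noteq> 0"
      using order_decomp[OF cp0, of 0] zero1 by (auto simp: poly_eq_0_iff_dvd)
    have zero: "poly f (s\<^sup>2) * poly (Yp k) s + poly \<rho> (- s\<^sup>2) * D s = 0" if "s \<noteq> 0" for s
    proof -
      let ?M = "s\<^sup>2 *\<^sub>R mat 1 - A ** B"
      have Mv: "?M *v vpoly Yp s = poly (popov h) s *\<^sub>R b"
        using id_s[of s] unfolding b_def
        by (simp add: matrix_vector_mult_diff_rdistrib flip: scaleR_matrix_vector_assoc)
      have "vpoly Yp s $ k * det ?M = det (\<chi> i j. if j = k then (poly (popov h) s *\<^sub>R b) $ i else ?M $ i $ j)"
        by (rule cramer_lemma[where A="?M" and x="vpoly Yp s" and k=k, unfolded Mv, symmetric])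
      also have "\<dots> = poly (popov h) s * D s"
        unfolding D_def vector_scaleR_component real_scaleR_def by (rule det_scale_column)
      finally have "poly (Yp k) s * poly (char_poly (A ** B)) (s\<^sup>2) = poly (popov h) s * D s"
        by (simp add: poly_char_poly)
      hence "s\<^sup>2 * (poly f (s\<^sup>2) * poly (Yp k) s + poly \<rho> (- s\<^sup>2) * D s) = 0"
        unfolding \<rho>0_at f(1) by (simp add: \<rho> algebra_simps)
      thus ?thesis using that by simp
    qed
    have "isCont D 0"
      unfolding D_def
    proof (rule continuous_det)
      fix i j
      show "isCont (\<lambda>s. (\<chi> i j. if j = k then b $ i else (s\<^sup>2 *\<^sub>R mat 1 - A ** B) $ i $ j) $ i $ j) 0"
        by (cases "j = k") simp_all
    qed
    hence "isCont (\<lambda>s. poly f (s\<^sup>2) * poly (Yp k) s + poly \<rho> (- s\<^sup>2) * D s) 0"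
      by (intro continuous_intros)
    hence lim: "(\<lambda>s. poly f (s\<^sup>2) * poly (Yp k) s + poly \<rho> (- s\<^sup>2) * D s)
       \<midarrow>0\<rightarrow> poly f (0\<^sup>2) * poly (Yp k) 0 + poly \<rho> (- 0\<^sup>2) * D 0"
      by (rule isContD)
    have "eventually (\<lambda>s. poly f (s\<^sup>2) * poly (Yp k) s + poly \<rho> (- s\<^sup>2) * D s = 0) (at 0)"
      using zero by (auto simp: eventually_at_filter)
    hence "((\<lambda>s::real. 0::real) \<longlongrightarrow> poly f (0\<^sup>2) * poly (Yp k) 0 + poly \<rho> (- 0\<^sup>2) * D 0) (at 0)"
      by (rule Lim_transform_eventually[OF lim])
    hence "poly f (0\<^sup>2) * poly (Yp k) 0 + poly \<rho> (- 0\<^sup>2) * D 0 = 0"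
      by (rule LIM_unique) (rule tendsto_const)
    hence "poly f 0 * poly (Yp k) 0 = 0" using r0 by simp
    moreover have "poly (Yp k) 0 = - (2 * (poly a 0)\<^sup>2 * v $ k)"
      using arg_cong[OF Y[of 0], of "\<lambda>x. x $ k"] arg_cong[OF U0, of "\<lambda>x. x $ k"]
      by (simp add: power2_eq_square)
    ultimately show False using f(2) k a_at_0 by simp
  qed
  have nz: "poly \<rho> z \<noteq> 0" if "z \<ge> 0" for z using nz_pos nz_0 that by (cases "z = 0") auto
  \<comment> \<open>No zeros on the half-line and leading coefficient 2: the sign follows from the
    intermediate value theorem.\<close>
  have "poly \<rho> z > 0" if z: "z \<ge> 0" for z
  proof (rule ccontr)
    assume "\<not> poly \<rho> z > 0"
    hence neg: "poly \<rho> z < 0" using nz[OF z] by simp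
    obtain N where N: "\<And>x. x \<ge> N \<Longrightarrow> poly \<rho> x \<ge> lead_coeff \<rho>"
      using poly_pinfty_gt_lc[of \<rho>] deg(2) by auto
    define w where "w = max N (z + 1)"
    have "poly \<rho> w > 0" using N[of w] deg(2) by (simp add: w_def)
    moreover have "z < w" by (simp add: w_def)
    ultimately obtain u where "z < u" "poly \<rho> u = 0" using poly_IVT_pos[of z w \<rho>] neg by blast
    thus False using nz[of u] z by simp
  qed
  thus ?thesis using \<rho>0 \<rho> deg by blast
qed

text \<open>A kernel vector x of \<open>B\<close> satisfies A x = (h \<bullet> x) g with h \<bullet>
  x \<noteq> 0, and is rescaled. In terms of the transfer function this is H(0) = -1.\<close>

lemma singular_direction:
  fixes h :: "real^'r" and B :: "real^'r^'r"
  assumes B: "B = A - outer g h" and zero: "poly (char_poly (A ** B)) 0 = 0"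
  shows "\<exists>v. A *v v = g \<and> h \<bullet> v = 1"
proof -
  have "det (0 *\<^sub>R mat 1 - A ** B) = 0" using zero unfolding poly_char_poly .
  then obtain x where x: "x \<noteq> 0" "(0 *\<^sub>R mat 1 - A ** B) *v x = 0" using det_zero_kernel by blast
  hence "A *v (B *v x) = 0" by (simp add: uminus_matvec matrix_vector_mul_assoc)
  hence "B *v x = 0" by (rule A_injective)
  hence Ax: "A *v x = (h \<bullet> x) *\<^sub>R g" by (simp add: B matrix_vector_mult_diff_rdistrib outer_matvec)
  have "h \<bullet> x \<noteq> 0" using Ax A_injective x(1) by auto
  thus ?thesis using Ax
    by (intro exI[of _ "(1 / (h \<bullet> x)) *\<^sub>R x"]) (simp add: matrix_vector_mult_scaleR)
qed

text \<open>Both \<open>popov h\<close> and the correction carry a factor s^2, the latter because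
  U(0) is a multiple of \<open>v\<close> and B v = 0. The quotient is factored as e(s) e(-s), and d
  = s e is then written as sqrt 2 a + q \<bullet> U.\<close>

lemma spectral_vector:
  fixes h :: "real^'r" and B :: "real^'r^'r"
  assumes B: "B = A - outer g h"
    and noneg: "\<forall>s::real. s < 0 \<longrightarrow> poly (char_poly (A ** B)) s \<noteq> 0"
    and zero1: "order 0 (char_poly (A ** B)) = 1"
    and v: "A *v v = g" "h \<bullet> v = 1"
  shows "\<exists>\<epsilon>>0. \<exists>q. q \<bullet> v = sqrt 2 \<and> (\<forall>s.
     (sqrt 2 * poly a s + q \<bullet> vpoly U s) * (sqrt 2 * poly a (-s) + q \<bullet> vpoly U (-s))
      = poly (popov h) s - \<epsilon> * ((B *v vpoly U s) \<bullet> (B *v vpoly U (-s))))"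
proof -
  let ?r = "CARD('r)"
  note U0 = vpoly_at_0[OF v(1)]
  have Bv: "B *v v = 0" by (simp add: B matrix_vector_mult_diff_rdistrib outer_matvec v)
  obtain \<rho> where \<rho>: "popov h = poly_negsq (pCons 0 \<rho>)" "degree \<rho> = ?r - 1" "\<And>z. z \<ge> 0 \<Longrightarrow> poly \<rho> z > 0"
    using popov_factor[OF B noneg zero1 v] by blast
  define V where "V j = poly_comb (B $ j) U" for j
  have V: "vpoly V s = B *v vpoly U s" for s
    by (simp add: vec_eq_iff V_def matrix_vector_mul_component)
  have "\<exists>t. V j = pCons 0 t" for j
  proof -
    have "vpoly V 0 = 0" by (simp add: V U0 Bv matvec_uminus matrix_vector_mult_scaleR)
    hence "poly (V j) 0 = 0" by (metis vpoly_nth zero_index)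
    thus ?thesis by (cases "V j") auto
  qed
  then obtain T where T: "\<And>j. V j = pCons 0 (T j)" by metis
  have degT: "degree (T j) \<le> ?r - 1" for j
  proof (rule degree_le, intro allI impI)
    fix k assume "?r - 1 < k"
    hence "coeff (V j) (Suc k) = 0" unfolding V_def by (intro coeff_comb) simp
    thus "coeff (T j) k = 0" by (simp add: T)
  qed
  define S where "S = (\<Sum>j\<in>UNIV. T j * poly_refl (T j))"
  have "poly_refl S = S"
    by (simp add: S_def pcompose_sum pcompose_mult mult.commute)
  then obtain \<tau> where \<tau>: "S = poly_negsq \<tau>" using even_poly_is_negsq by blast
  \<comment> \<open>Entries of \<open>U\<close> have degree below r, so \<tau> has degree at most r
    - 1, the degree of \<rho>: the perturbation cannot dominate at infinity.\<close>
  have "degree S \<le> 2 * (?r - 1)" unfolding S_def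
  proof (rule degree_sum_le)
    show "degree (T j * poly_refl (T j)) \<le> 2 * (?r - 1)" for j
      using degree_mult_le[of "T j" "poly_refl (T j)"] degT[of j] by simp
  qed simp
  hence "degree \<tau> \<le> degree \<rho>" unfolding \<tau> \<rho>(2) by (simp add: degree_pcompose)
  then obtain \<epsilon> where \<epsilon>: "\<epsilon> > 0" "\<And>z. z \<ge> 0 \<Longrightarrow> poly (\<rho> - smult \<epsilon> \<tau>) z > 0"
    using poly_perturb_pos[OF \<rho>(3)] by blast
  obtain e where e: "e * poly_refl e = poly_negsq (\<rho> - smult \<epsilon> \<tau>)"
    using spectral_factor[OF \<epsilon>(2)] by blast
  define R where "R = popov h - smult \<epsilon> (\<Sum>j\<in>UNIV. V j * poly_refl (V j))"
  define d where "d = pCons 0 e"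
  have "poly d 0 = 0" by (simp add: d_def)
  have e_at: "poly e s * poly e (-s) = poly \<rho> (-s\<^sup>2) - \<epsilon> * (\<Sum>j\<in>UNIV. poly (T j) s * poly (T j) (-s))" for s
    using arg_cong[OF e, of "\<lambda>p. poly p s"] arg_cong[OF \<tau>, of "\<lambda>p. poly p s"]
    by (simp add: poly_pcompose power2_eq_square S_def poly_sum)
  have dR: "d * poly_refl d = R"
  proof (rule poly_eqI_fun)
    fix s
    have "poly (d * poly_refl d) s = - s\<^sup>2 * (poly e s * poly e (-s))"
      by (simp add: d_def poly_pcompose power2_eq_square)
    also have "\<dots> = poly R s"
      unfolding e_at R_def \<rho>(1)
      by (simp add: poly_pcompose T poly_sum sum_distrib_left power2_eq_square algebra_simps sum_negf)
    finally show "poly (d * poly_refl d) s = poly R s" .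
  qed
  have zV: "coeff (V j * poly_refl (V j)) k = 0" if "k \<ge> 2 * ?r" for j k
    using that by (intro coeff_mult_eq_0[of ?r _ ?r]) (auto simp: V_def coeff_comb coeff_poly_refl)
  have R_top: "coeff R (2 * ?r) = 2 * (-1) ^ ?r" "\<And>k. k > 2 * ?r \<Longrightarrow> coeff R k = 0"
    by (simp_all add: R_def coeff_sum zV coeff_popov_top)
  have "degree R = 2 * ?r"
    using R_top by (intro order.antisym degree_le le_degree) auto
  moreover have "d \<noteq> 0"
  proof
    assume "d = 0"
    hence "R = 0" using dR by simp
    thus False using R_top(1) by simp
  qed
  hence "degree R = 2 * degree d"
    unfolding dR[symmetric] by (simp add: degree_mult_eq pcompose_eq_0_iff)
  ultimately have deg_d: "degree d = ?r" by simp
  have "(coeff d ?r)\<^sup>2 = 2"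
    using coeff_mult_poly_refl_top[of d ?r] deg_d R_top(1) unfolding dR by simp
  hence lead_d: "\<bar>coeff d ?r\<bar> = sqrt 2" by (metis real_sqrt_abs)
  \<comment> \<open>The sign is chosen so that the leading coefficient is sqrt 2; then d' - sqrt 2 a
    has degree below r and is a combination of the entries of \<open>U\<close>.\<close>
  define d' where "d' = (if coeff d ?r \<ge> 0 then d else - d)"
  have d': "d' * poly_refl d' = R" "coeff d' ?r = sqrt 2" "degree d' = ?r" "poly d' 0 = 0"
    using dR lead_d deg_d \<open>poly d 0 = 0\<close> by (auto simp: d'_def pcompose_uminus)
  have "coeff (d' - smult (sqrt 2) a) k = 0" if "k \<ge> ?r" for k
    using that d'(2,3) deg_a lead_a by (cases "k = ?r") (auto simp: coeff_eq_0)
  then obtain q where q: "poly_comb q U = d' - smult (sqrt 2) a"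
    using comb_surjective[of "d' - smult (sqrt 2) a"] by blast
  have q_at: "sqrt 2 * poly a s + q \<bullet> vpoly U s = poly d' s" for s
    using arg_cong[OF q, of "\<lambda>p. poly p s"] by simp
  \<comment> \<open>Evaluation at s = 0, where d' vanishes and U(0) = - a(0) v.\<close>
  have "q \<bullet> v = sqrt 2"
    using q_at[of 0] d'(4) a_at_0 by (simp add: U0 algebra_simps)
  moreover have "(sqrt 2 * poly a s + q \<bullet> vpoly U s) * (sqrt 2 * poly a (-s) + q \<bullet> vpoly U (-s))
      = poly (popov h) s - \<epsilon> * ((B *v vpoly U s) \<bullet> (B *v vpoly U (-s)))" for s
    unfolding q_at
    using arg_cong[OF d'(1), of "\<lambda>p. poly p s"]
    by (simp add: poly_pcompose R_def poly_sum inner_vec_def flip: V)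
  ultimately show ?thesis using \<epsilon>(1) by blast
qed

text \<open>The Lyapunov equation is tested with U(-s) and U(s); the terms with factors s and -s
  cancel and only those with \<open>g\<close> remain.\<close>

lemma lyapunov_popov_identity:
  fixes P W :: "real^'r^'r"
  assumes P: "transpose P = P" "transpose A ** P + P ** A = - W"
  shows "vpoly U (-s) \<bullet> (W *v vpoly U s)
    = poly a (-s) * ((P *v g) \<bullet> vpoly U s) + poly a s * ((P *v g) \<bullet> vpoly U (-s))"
proof -
  let ?u = "vpoly U s" and ?w = "vpoly U (-s)"
  have sym: "x \<bullet> (P *v y) = (P *v x) \<bullet> y" for x y by (metis P(1) inner_transpose_matvec)
  have "- (?w \<bullet> (W *v ?u)) = ?w \<bullet> ((transpose A ** P + P ** A) *v ?u)"
    by (simp add: P(2) uminus_matvec)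
  also have "\<dots> = (A *v ?w) \<bullet> (P *v ?u) + (P *v ?w) \<bullet> (A *v ?u)"
    by (simp add: matrix_vector_mult_add_rdistrib inner_add_right inner_transpose_matvec sym
        flip: matrix_vector_mul_assoc)
  also have "\<dots> = - (poly a (-s) * ((P *v g) \<bullet> ?u)) - poly a s * ((P *v g) \<bullet> ?w)"
  proof -
    have "(P *v ?w) \<bullet> g = (P *v g) \<bullet> ?w" by (metis sym inner_commute)
    thus ?thesis unfolding resolvent
      by (simp add: inner_diff_left inner_diff_right sym matrix_vector_mult_diff_distrib
          matvec_uminus matrix_vector_mult_scaleR)
  qed
  finally show ?thesis by simp
qed

text \<open>\<open>P\<close> is fixed by the Lyapunov equation alone. The second relation, P g = h -
  sqrt 2 q, is not imposed but deduced by comparing the Lyapunov identity with the spectral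
  factorization.\<close>

lemma common_lyapunov_matrix:
  fixes h :: "real^'r" and B :: "real^'r^'r"
  assumes B: "B = A - outer g h"
    and noneg: "\<forall>s::real. s < 0 \<longrightarrow> poly (char_poly (A ** B)) s \<noteq> 0"
    and zero1: "order 0 (char_poly (A ** B)) = 1"
  shows "\<exists>P. transpose P = P \<and> (\<forall>x. x \<noteq> 0 \<longrightarrow> x \<bullet> (P *v x) > 0) \<and>
    (\<forall>w. w \<noteq> 0 \<longrightarrow> w \<bullet> (P *v (A *v w)) < 0) \<and> (\<forall>w. B *v w \<noteq> 0 \<longrightarrow> w \<bullet> (P *v (B *v w)) < 0)"
proof -
  have "poly (char_poly (A ** B)) 0 = 0"
    using zero1 order_root[of "char_poly (A ** B)" 0] by simp
  then obtain v where v: "A *v v = g" "h \<bullet> v = 1" using singular_direction[OF B] by blast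
  obtain \<epsilon> q where \<epsilon>: "\<epsilon> > 0" and qv: "q \<bullet> v = sqrt 2" and q:
    "\<And>s. (sqrt 2 * poly a s + q \<bullet> vpoly U s) * (sqrt 2 * poly a (-s) + q \<bullet> vpoly U (-s))
      = poly (popov h) s - \<epsilon> * ((B *v vpoly U s) \<bullet> (B *v vpoly U (-s)))"
    using spectral_vector[OF B noneg zero1 v] by blast
  define W where "W = outer q q + \<epsilon> *\<^sub>R (transpose B ** B)"
  have W_form: "x \<bullet> (W *v y) = (q \<bullet> x) * (q \<bullet> y) + \<epsilon> * ((B *v x) \<bullet> (B *v y))" for x y
    by (simp add: W_def matrix_vector_mult_add_rdistrib inner_add_right outer_matvec inner_commute
        inner_transpose_matvec flip: scaleR_matrix_vector_assoc matrix_vector_mul_assoc)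
  have symW: "transpose W = W"
    by (simp add: W_def vec_eq_iff transpose_def outer_def matrix_matrix_mult_def mult.commute)
  have "transpose (- W) = - W" using symW by (simp add: transpose_def vec_eq_iff)
  then obtain P where P: "transpose P = P" "transpose A ** P + P ** A = - W"
    using lyapunov_solution[OF hurwitz] by blast
  have Bx: "B *v x = A *v x - (h \<bullet> x) *\<^sub>R g" for x
    by (simp add: B matrix_vector_mult_diff_rdistrib outer_matvec)
  \<comment> \<open>If both squares vanish, x lies in the kernel of \<open>B\<close>, spanned by
    \<open>v\<close>, and q \<bullet> v = sqrt 2 leaves only x = 0.\<close>
  have W_pos: "x \<bullet> (W *v x) > 0" if "x \<noteq> 0" for x
  proof (rule ccontr)
    assume "\<not> x \<bullet> (W *v x) > 0"
    hence "(q \<bullet> x)\<^sup>2 + \<epsilon> * ((B *v x) \<bullet> (B *v x)) \<le> 0" unfolding W_form power2_eq_square by simp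
    moreover have "\<epsilon> * ((B *v x) \<bullet> (B *v x)) \<ge> 0" using \<epsilon> by simp
    moreover have "(q \<bullet> x)\<^sup>2 \<ge> 0" by simp
    ultimately have "(q \<bullet> x)\<^sup>2 = 0" "\<epsilon> * ((B *v x) \<bullet> (B *v x)) = 0" by linarith+
    hence qx: "q \<bullet> x = 0" and "B *v x = 0" using \<epsilon> by auto
    hence "A *v (x - (h \<bullet> x) *\<^sub>R v) = 0"
      unfolding Bx by (simp add: matrix_vector_mult_diff_distrib matrix_vector_mult_scaleR v)
    hence x: "x = (h \<bullet> x) *\<^sub>R v" using A_injective by fastforce
    have "q \<bullet> x = (h \<bullet> x) * sqrt 2" by (subst x) (simp add: qv)
    hence "h \<bullet> x = 0" using qx by simp
    thus False using x that by simp
  qed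
  define f where "f = P *v g - h + sqrt 2 *\<^sub>R q"
  have "poly_refl a * poly_comb f U + a * poly_refl (poly_comb f U) = 0"
  proof (rule poly_eqI_fun)
    fix s
    let ?a = "poly a s" and ?a' = "poly a (-s)" and ?u = "vpoly U s" and ?w = "vpoly U (-s)"
    have "?a' * ((P *v g) \<bullet> ?u) + ?a * ((P *v g) \<bullet> ?w)
       = (q \<bullet> ?w) * (q \<bullet> ?u) + \<epsilon> * ((B *v ?w) \<bullet> (B *v ?u))"
      unfolding lyapunov_popov_identity[OF P, symmetric] W_form ..
    also have "\<epsilon> * ((B *v ?w) \<bullet> (B *v ?u)) = poly (popov h) s - (sqrt 2 * ?a + q \<bullet> ?u) * (sqrt 2 * ?a' + q \<bullet> ?w)"
      unfolding q by (simp add: inner_commute)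
    also have "\<dots> = ?a' * (h \<bullet> ?u) + ?a * (h \<bullet> ?w) - sqrt 2 * (?a * (q \<bullet> ?w) + ?a' * (q \<bullet> ?u)) - (q \<bullet> ?u) * (q \<bullet> ?w)"
      unfolding poly_popov by (simp add: algebra_simps)
    finally have "?a' * (f \<bullet> ?u) + ?a * (f \<bullet> ?w) = 0"
      unfolding f_def by (simp add: inner_add_left inner_diff_left algebra_simps)
    thus "poly (poly_refl a * poly_comb f U + a * poly_refl (poly_comb f U)) s = poly 0 s"
      by (simp add: poly_pcompose)
  qed
  \<comment> \<open>The polynomial identity is evaluated at \<open>A\<close> on \<open>g\<close>.
    The summand with factor a(A) drops out, a(-A) is cancelled by injectivity, and what is left has
    degree below r.\<close>
  hence "poly_apply (poly_refl a * poly_comb f U + a * poly_refl (poly_comb f U)) A g = 0" by simp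
  hence "poly_apply (poly_refl a) A (poly_apply (poly_comb f U) A g) = 0"
    unfolding poly_apply_add poly_apply_mult'[of a] annihil by (simp add: poly_apply_mult)
  hence "poly_apply (poly_comb f U) A g = 0"
    by (rule hurwitz_poly_refl_apply_inj[OF hurwitz hurwitz_a a_nonzero])
  hence "poly_comb f U = 0" by (rule krylov_independent[OF ctrb degree_comb])
  hence "f = 0" by (rule comb_injective)
  hence Pg: "P *v g = h - sqrt 2 *\<^sub>R q" by (simp add: f_def algebra_simps)
  have PA: "w \<bullet> (P *v (A *v w)) = - (w \<bullet> (W *v w)) / 2" for w
  proof -
    have "- (w \<bullet> (W *v w)) = w \<bullet> ((transpose A ** P + P ** A) *v w)" by (simp add: P(2) uminus_matvec)
    also have "\<dots> = (A *v w) \<bullet> (P *v w) + w \<bullet> (P *v (A *v w))"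
      by (simp add: matrix_vector_mult_add_rdistrib inner_add_right inner_transpose_matvec
          flip: matrix_vector_mul_assoc)
    also have "(A *v w) \<bullet> (P *v w) = w \<bullet> (P *v (A *v w))"
      by (metis P(1) inner_commute inner_transpose_matvec)
    finally show ?thesis by simp
  qed
  have "w \<bullet> (P *v (B *v w)) < 0" if "B *v w \<noteq> 0" for w
  proof -
    have "w \<bullet> (P *v (B *v w)) = w \<bullet> (P *v (A *v w)) - (h \<bullet> w) * (w \<bullet> (P *v g))"
      unfolding Bx by (simp add: matrix_vector_mult_diff_distrib matrix_vector_mult_scaleR inner_diff_right)
    also have "\<dots> = - ((q \<bullet> w - sqrt 2 * (h \<bullet> w))\<^sup>2 + \<epsilon> * ((B *v w) \<bullet> (B *v w))) / 2"
      unfolding PA W_form Pg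
      by (simp add: inner_diff_right power2_eq_square algebra_simps inner_commute) (simp add: field_simps)
    also have "\<dots> < 0"
    proof -
      have "\<epsilon> * ((B *v w) \<bullet> (B *v w)) > 0" using \<epsilon> that by simp
      hence "(q \<bullet> w - sqrt 2 * (h \<bullet> w))\<^sup>2 + \<epsilon> * ((B *v w) \<bullet> (B *v w)) > 0" by (intro add_nonneg_pos) auto
      thus ?thesis by (intro divide_neg_pos neg_less_0_iff_less[THEN iffD2]) simp_all
    qed
    finally show ?thesis .
  qed
  moreover have "w \<bullet> (P *v (A *v w)) < 0" if "w \<noteq> 0" for w
    using W_pos[OF that] unfolding PA by simp
  moreover have "x \<bullet> (P *v x) > 0" if "x \<noteq> 0" for x
    using lyapunov_pos_def[OF hurwitz P(2) symW W_pos that] .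
  ultimately show ?thesis using P(1) by blast
qed

end

section \<open>Reduction of descriptor systems\<close>

lemma det_zero_if_kernel:
  fixes M :: "complex^'n^'n"
  assumes "M *v x = 0" "x \<noteq> 0"
  shows "det M = 0"
  using assms by (metis invertible_det_nz invertible_left_inverse matrix_left_invertible_ker)

text \<open>The image of a basis of \<open>V\<close> spans \<open>V\<close> with at most dim V
  elements, so it is independent and no elements are merged.\<close>

lemma linear_surj_on_imp_kernel_trivial:
  fixes f :: "'a::euclidean_space \<Rightarrow> 'a"
  assumes f: "linear f" and V: "subspace V" and img: "f ` V = V" and x: "x \<in> V" "f x = 0"
  shows "x = 0"
proof -
  obtain C where C: "C \<subseteq> V" "independent C" "V \<subseteq> span C" "card C = dim V"
    using basis_exists[of V] by blast
  have fin: "finite C" using C(2) independent_imp_finite by blast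
  have span: "V \<subseteq> span (f ` C)"
    using C(3) img linear_span_image[OF f, of C] by blast
  have le: "card (f ` C) \<le> dim V" using card_image_le[OF fin, of f] C(4) by simp
  have "f ` C \<subseteq> V" using C(1) img by blast
  hence indep: "independent (f ` C)"
    using card_le_dim_spanning span fin le by blast
  have "dim V \<le> card (f ` C)" using span fin by (intro dim_le_card) auto
  hence "inj_on f C" using fin le C(4) by (intro eq_card_imp_inj_on) auto
  thus ?thesis using linear_indep_image_lemma[OF f fin indep] x C(3) by blast
qed

lemma complex_pencil_matvec:
  fixes E A :: "real^'n^'n" and a b :: "real^'n"
  shows "((\<chi> i j. s * complex_of_real (E$i$j) - complex_of_real (A$i$j))
      *v (\<chi> k. of_real (a $ k) + \<i> * of_real (b $ k))) $ i
   = s * (of_real ((E *v a) $ i) + \<i> * of_real ((E *v b) $ i))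
     - (of_real ((A *v a) $ i) + \<i> * of_real ((A *v b) $ i))"
  by (simp add: matrix_vector_mult_def sum_distrib_left sum_subtractf sum.distrib algebra_simps)

text \<open>\<open>F\<close> recovers x from the derivative of Y^T x, and \<open>Et\<close> recovers
  Y^T x from it.\<close>

locale descriptor =
  fixes E A :: "real^'n^'n" and X Y :: "real^'r^'n" and F :: "real^'r^'n" and Et :: "real^'r^'r"
  assumes inv: "invertible A" and frd: "full_rank_decomp E X Y"
    and F_def: "F = matrix_inv A ** X" and Et_def: "Et = transpose Y ** F"
begin

lemma A_matrix_inv: "A ** matrix_inv A = mat 1" "matrix_inv A ** A = mat 1"
  using someI_ex[OF inv[unfolded invertible_def]] by (simp_all add: matrix_inv_def)

lemma AF: "A *v (F *v u) = X *v u"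
  by (simp add: F_def matrix_vector_mul_assoc matrix_mul_assoc A_matrix_inv)

lemma E_matvec: "E *v x = X *v (transpose Y *v x)"
  using frd by (simp add: full_rank_decomp_def matrix_vector_mul_assoc)

lemma Et_matvec: "Et *v u = transpose Y *v (F *v u)"
  by (simp add: Et_def matrix_vector_mul_assoc)

lemma X_injective: "X *v u = X *v w \<Longrightarrow> u = w"
  using frd full_rank_injective[of X] by (auto simp: full_rank_decomp_def inj_def)

lemma F_injective: "F *v u = F *v w \<Longrightarrow> u = w"
  by (metis AF X_injective)

lemma Yt_surjective: "\<exists>x. transpose Y *v x = u"
proof -
  have "rank (transpose Y) = CARD('r)" using frd by (simp add: full_rank_decomp_def rank_transpose)
  hence "surj ((*v) (transpose Y))" by (simp add: full_rank_surjective)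
  thus ?thesis by (metis surjD)
qed

lemma descriptor_eq:
  assumes "E *v w = A *v x"
  shows "x = F *v (transpose Y *v w)" "transpose Y *v x = Et *v (transpose Y *v w)"
proof -
  have "matrix_inv A *v (A *v x) = matrix_inv A *v (X *v (transpose Y *v w))"
    using assms E_matvec by simp
  thus "x = F *v (transpose Y *v w)"
    by (simp add: matrix_vector_mul_assoc matrix_mul_assoc A_matrix_inv F_def)
  thus "transpose Y *v x = Et *v (transpose Y *v w)" using Et_matvec by simp
qed

text \<open>The power k + 1 of A^-1 E contains only the power k of \<open>Et\<close>. As
  \<open>F\<close> is injective and Y^T onto, every statement about the index shifts down by
  one.\<close>

lemma matpow_matvec:
  "matpow (matrix_inv A ** E) (Suc k) *v x = F *v (matpow Et k *v (transpose Y *v x))"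
proof (induction k)
  case 0
  show ?case
    using frd by (simp add: matpow_def full_rank_decomp_def F_def matrix_vector_mul_assoc matrix_mul_assoc)
next
  case (Suc k)
  have "matpow (matrix_inv A ** E) (Suc (Suc k)) *v x
     = matrix_inv A *v (E *v (matpow (matrix_inv A ** E) (Suc k) *v x))"
    by (simp add: matpow_def matrix_vector_mul_assoc matrix_mul_assoc)
  also have "\<dots> = F *v (Et *v (matpow Et k *v (transpose Y *v x)))"
    unfolding Suc E_matvec Et_matvec by (simp add: F_def matrix_vector_mul_assoc matrix_mul_assoc)
  finally show ?case by (simp add: matpow_def matrix_vector_mul_assoc matrix_mul_assoc)
qed

lemma mat_image_matpow:
  "mat_image (matpow (matrix_inv A ** E) (Suc k)) = range (\<lambda>u. F *v (matpow Et k *v u))"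
proof -
  have "range (\<lambda>u. F *v (matpow Et k *v u)) \<subseteq> range (\<lambda>x. F *v (matpow Et k *v (transpose Y *v x)))"
    using Yt_surjective by (metis image_subsetI rangeI)
  thus ?thesis unfolding mat_image_def matpow_matvec by auto
qed

text \<open>The \<open>LEAST\<close> in the definition is attained: the images decrease, and their
  dimensions cannot drop forever.\<close>

lemma desc_index_image:
  "mat_image (matpow (matrix_inv A ** E) (Suc (desc_index E A)))
    = mat_image (matpow (matrix_inv A ** E) (desc_index E A))"
proof -
  define M where "M = matrix_inv A ** E"
  define D where "D k = mat_image (matpow M k)" for k
  have sub: "subspace (D k)" for k
    unfolding D_def mat_image_def by (intro linear_subspace_image) auto
  have Suc_M: "matpow M (Suc k) = matpow M k ** M" for k
    by (induction k) (simp_all add: matpow_def matrix_mul_assoc)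
  have mono: "D (Suc k) \<subseteq> D k" for k
    unfolding D_def mat_image_def Suc_M by (auto simp flip: matrix_vector_mul_assoc)
  have "\<exists>k. D (Suc k) = D k"
  proof (rule ccontr)
    assume "\<nexists>k. D (Suc k) = D k"
    hence lt: "dim (D (Suc k)) < dim (D k)" for k
      using mono[of k] sub dim_subset[OF mono[of k]] subspace_dim_equal[OF sub sub mono[of k]]
      by (metis linorder_not_less)
    have "dim (D k) + k \<le> dim (D 0)" for k
    proof (induction k)
      case (Suc k)
      thus ?case using lt[of k] by simp
    qed simp
    from this[of "Suc (dim (D 0))"] show False by simp
  qed
  hence "D (Suc (LEAST k. D (Suc k) = D k)) = D (LEAST k. D (Suc k) = D k)" by (rule LeastI_ex)
  thus ?thesis unfolding desc_index_def D_def M_def .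
qed

text \<open>After the shift, index one says that \<open>Et\<close> has the same range as the
  identity.\<close>

lemma index_one_injective:
  assumes "desc_index E A = 1" "Et *v u = 0"
  shows "u = 0"
proof -
  have "range (\<lambda>u. F *v (matpow Et (Suc 0) *v u)) = range (\<lambda>u. F *v (matpow Et 0 *v u))"
    using desc_index_image unfolding assms(1) mat_image_matpow
    using mat_image_matpow[of 0] mat_image_matpow[of "Suc 0"] by simp
  hence eq: "range (\<lambda>u. F *v (Et *v u)) = range (\<lambda>u. F *v u)" by (simp add: matpow_def)
  have "\<exists>w. Et *v w = u" for u
  proof -
    have "F *v u \<in> range (\<lambda>u. F *v (Et *v u))" unfolding eq by blast
    then obtain w where "F *v u = F *v (Et *v w)" by blast
    thus ?thesis using F_injective by blast
  qed
  hence "surj ((*v) Et)" unfolding surj_def by metis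
  hence "inj ((*v) Et)" using linear_surjective_imp_injective[OF matrix_vector_mul_linear, of Et] by simp
  thus ?thesis using assms(2) by (metis injD matrix_vector_mult_0_right)
qed

text \<open>After the shift, index two says that \<open>Et\<close> maps its range onto itself; it is
  then injective there, which applies to the vector \<open>Et *v u\<close>.\<close>

lemma index_two_kernel:
  assumes "desc_index E A = 2" "Et *v (Et *v u) = 0"
  shows "Et *v u = 0"
proof -
  have "range (\<lambda>u. F *v (matpow Et (Suc (Suc 0)) *v u)) = range (\<lambda>u. F *v (matpow Et (Suc 0) *v u))"
    using desc_index_image unfolding assms(1)
    using mat_image_matpow[of "Suc 0"] mat_image_matpow[of "Suc (Suc 0)"] by (simp add: numeral_2_eq_2)
  hence "range (\<lambda>u. F *v ((Et ** Et) *v u)) = range (\<lambda>u. F *v (Et *v u))" by (simp add: matpow_def)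
  hence "(*v) F ` range ((*v) (Et ** Et)) = (*v) F ` range ((*v) Et)" by (simp add: image_image)
  moreover have "inj ((*v) F)" using F_injective by (auto intro: injI)
  ultimately have "range ((*v) (Et ** Et)) = range ((*v) Et)" by (simp add: inj_image_eq_iff)
  hence img: "(*v) Et ` range ((*v) Et) = range ((*v) Et)"
    by (simp add: image_image matrix_vector_mul_assoc)
  show ?thesis
  proof (rule linear_surj_on_imp_kernel_trivial[OF matrix_vector_mul_linear _ img _ assms(2)])
    show "subspace (range ((*v) Et))" by (intro linear_subspace_image) auto
  qed simp
qed

text \<open>If \<open>Et\<close> has eigenvalue l with vector u, then 1/l is a root of det(s E - A)
  with vector F u, since E F u = X Et u and A F u = X u. Injectivity excludes l = 0, and Re l and Re
  (1/l) have the same sign.\<close>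

lemma stable_hurwitz:
  assumes stab: "desc_stable E A" and inj: "\<And>u. Et *v u = 0 \<Longrightarrow> u = 0"
  shows "hurwitz_mat Et"
  unfolding hurwitz_mat_def
proof (intro allI impI, elim conjE)
  fix \<mu> \<omega> p q
  assume p: "Et *v p = \<mu> *\<^sub>R p - \<omega> *\<^sub>R q" and q: "Et *v q = \<omega> *\<^sub>R p + \<mu> *\<^sub>R q" and nz: "p \<noteq> 0 \<or> q \<noteq> 0"
  define l where "l = Complex \<mu> \<omega>"
  have l0: "l \<noteq> 0"
  proof
    assume "l = 0"
    hence "\<mu> = 0" "\<omega> = 0" by (simp_all add: l_def complex_eq_iff)
    thus False using p q inj nz by auto
  qed
  let ?C = "\<chi> i j. (1 / l) * complex_of_real (E$i$j) - complex_of_real (A$i$j)"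
  define z :: "complex^'n" where "z = (\<chi> k. of_real ((F *v p) $ k) + \<i> * of_real ((F *v q) $ k))"
  have "?C *v z = 0"
  proof -
    have "(?C *v z) $ i = 0" for i
    proof -
      have E: "E *v (F *v u) = X *v (Et *v u)" for u by (simp add: E_matvec Et_matvec)
      define x1 x2 where "x1 = (X *v p) $ i" and "x2 = (X *v q) $ i"
      have e: "(E *v (F *v p)) $ i = \<mu> * x1 - \<omega> * x2" "(E *v (F *v q)) $ i = \<omega> * x1 + \<mu> * x2"
        unfolding E p q x1_def x2_def
        by (simp_all add: matrix_vector_mult_diff_distrib matrix_vector_right_distrib matrix_vector_mult_scaleR)
      have "complex_of_real (\<mu> * x1 - \<omega> * x2) + \<i> * of_real (\<omega> * x1 + \<mu> * x2)
          = l * (of_real x1 + \<i> * of_real x2)"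
        by (simp add: l_def complex_eq_iff)
      thus ?thesis
        unfolding z_def complex_pencil_matvec e AF x1_def[symmetric] x2_def[symmetric] using l0 by simp
    qed
    thus ?thesis by (simp add: vec_eq_iff)
  qed
  moreover have "z \<noteq> 0"
  proof
    assume "z = 0"
    hence "F *v p = 0" "F *v q = 0" by (auto simp: z_def vec_eq_iff complex_eq_iff)
    hence "p = 0" "q = 0" using F_injective by (metis matrix_vector_mult_0_right)+
    thus False using nz by simp
  qed
  ultimately have "det ?C = 0" by (rule det_zero_if_kernel)
  hence "Re (1 / l) < 0" using stab unfolding desc_stable_def by blast
  hence "\<mu> / (\<mu>\<^sup>2 + \<omega>\<^sup>2) < 0" by (simp add: l_def Re_divide)
  thus "\<mu> < 0" using sum_power2_ge_zero[of \<mu> \<omega>] by (auto simp: divide_less_0_iff)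
qed

end

section \<open>Decay of switched solutions\<close>

text \<open>Integrating the derivative bridges the switching instants, where only continuity is
  known.\<close>

lemma nonincreasing_finite_exceptions:
  fixes f :: "real \<Rightarrow> real"
  assumes ab: "a \<le> b" and cont: "continuous_on {a..b} f" and S: "finite S"
    and der: "\<And>t. t \<in> {a<..<b} - S \<Longrightarrow> \<exists>D\<le>0. (f has_real_derivative D) (at t)"
  shows "f b \<le> f a"
proof -
  obtain D where D: "\<And>t. t \<in> {a<..<b} - S \<Longrightarrow> D t \<le> 0 \<and> (f has_real_derivative D t) (at t)"
    using der by metis
  define f' where "f' t = (if t \<in> {a<..<b} - S then D t else 0)" for t
  have "(f' has_integral (f b - f a)) {a..b}"
  proof (rule fundamental_theorem_of_calculus_interior_strong[OF S ab _ cont])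
    show "(f has_vector_derivative f' t) (at t)" if "t \<in> {a<..<b} - S" for t
      using D[OF that] that by (simp add: f'_def has_real_derivative_iff_has_vector_derivative)
  qed
  moreover have "((\<lambda>_. 0::real) has_integral 0) {a..b}" by simp
  moreover have "f' t \<le> 0" for t using D[of t] by (simp add: f'_def)
  ultimately have "f b - f a \<le> 0" by (rule has_integral_le)
  thus ?thesis by simp
qed

text \<open>Difference quotients stay in \<open>V\<close>, and \<open>V\<close> is closed. It places
  y' in the range of the active \<open>Et\<close>, where the dissipation estimate holds.\<close>

lemma has_vector_derivative_in_subspace:
  fixes f :: "real \<Rightarrow> 'a::euclidean_space"
  assumes V: "subspace V" and ev: "\<forall>\<^sub>F u in nhds t. f u \<in> V" and der: "(f has_vector_derivative w) (at t)"
  shows "w \<in> V"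
proof (rule Lim_in_closed_set[OF closed_subspace[OF V]])
  show "((\<lambda>u. (f u - f t) /\<^sub>R (u - t)) \<longlongrightarrow> w) (at t)"
    using der unfolding has_vector_derivative_def has_derivative_at2
  proof (elim conjE)
    assume "((\<lambda>y. (1 / norm (y - t)) *\<^sub>R (f y - (f t + (y - t) *\<^sub>R w))) \<longlongrightarrow> 0) (at t)"
    hence "((\<lambda>y. norm ((1 / norm (y - t)) *\<^sub>R (f y - (f t + (y - t) *\<^sub>R w)))) \<longlongrightarrow> 0) (at t)"
      by (rule tendsto_norm_zero)
    moreover have "\<forall>\<^sub>F y in at t. norm ((1 / norm (y - t)) *\<^sub>R (f y - (f t + (y - t) *\<^sub>R w)))
        = norm ((f y - f t) /\<^sub>R (y - t) - w)"
      unfolding eventually_at_filter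
    proof (rule always_eventually, intro allI impI)
      fix y assume "y \<noteq> t"
      hence "f y - (f t + (y - t) *\<^sub>R w) = (y - t) *\<^sub>R ((f y - f t) /\<^sub>R (y - t) - w)"
        unfolding scaleR_diff_right[of "y - t" "(f y - f t) /\<^sub>R (y - t)" w] by simp
      thus "norm ((1 / norm (y - t)) *\<^sub>R (f y - (f t + (y - t) *\<^sub>R w))) = norm ((f y - f t) /\<^sub>R (y - t) - w)"
        using \<open>y \<noteq> t\<close> by simp
    qed
    ultimately have "((\<lambda>y. norm ((f y - f t) /\<^sub>R (y - t) - w)) \<longlongrightarrow> 0) (at t)"
      by (rule Lim_transform_eventually)
    thus ?thesis using LIM_zero_iff tendsto_norm_zero_iff by blast
  qed
  have "f t \<in> V" using ev eventually_nhds_x_imp_x by blast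
  moreover have "\<forall>\<^sub>F u in at t. f u \<in> V"
    using ev by (auto simp: eventually_at_filter elim: eventually_mono)
  ultimately show "\<forall>\<^sub>F u in at t. (f u - f t) /\<^sub>R (u - t) \<in> V"
    using V by (auto elim!: eventually_mono intro: subspace_diff subspace_scale)
qed simp

section \<open>Switching signals near a point\<close>

lemma eventually_eq_discrete:
  fixes f :: "'a \<Rightarrow> nat"
  assumes "(f \<longlongrightarrow> i) F"
  shows "\<forall>\<^sub>F u in F. f u = i"
  using topological_tendstoD[OF assms, of "{i}"] by (simp add: open_discrete)

lemma isCont_nat_iff_locally_constant:
  fixes \<sigma> :: "real \<Rightarrow> nat"
  shows "isCont \<sigma> t \<longleftrightarrow> (\<forall>\<^sub>F u in nhds t. \<sigma> u = \<sigma> t)"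
proof
  assume "isCont \<sigma> t"
  hence "(\<sigma> \<longlongrightarrow> \<sigma> t) (nhds t)" by (simp add: tendsto_at_iff_tendsto_nhds isCont_def)
  thus "\<forall>\<^sub>F u in nhds t. \<sigma> u = \<sigma> t" by (rule eventually_eq_discrete)
next
  assume "\<forall>\<^sub>F u in nhds t. \<sigma> u = \<sigma> t"
  hence "(\<sigma> \<longlongrightarrow> \<sigma> t) (nhds t)" by (intro tendsto_eventually)
  thus "isCont \<sigma> t" by (simp add: tendsto_at_iff_tendsto_nhds isCont_def)
qed

lemma isCont_nat_if_constant_open:
  fixes \<sigma> :: "real \<Rightarrow> nat"
  assumes "open S" "t \<in> S" "\<And>u. u \<in> S \<Longrightarrow> \<sigma> u = i"
  shows "isCont \<sigma> t"
  unfolding isCont_nat_iff_locally_constant eventually_nhds using assms by metis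

text \<open>The value of a switching signal at a switching instant is irrelevant to the dynamics;
  the active mode is read off to the right.\<close>

definition right_mode :: "(real \<Rightarrow> nat) \<Rightarrow> real \<Rightarrow> nat" where
  "right_mode \<sigma> t = (SOME j. \<forall>\<^sub>F u in at_right t. \<sigma> u = j)"

lemma right_mode_eqI:
  assumes "\<forall>\<^sub>F u in at_right t. \<sigma> u = j"
  shows "right_mode \<sigma> t = j"
proof -
  have "\<forall>\<^sub>F u in at_right t. \<sigma> u = right_mode \<sigma> t"
    unfolding right_mode_def using assms by (rule someI)
  with assms have "\<forall>\<^sub>F u in at_right t. right_mode \<sigma> t = j" by eventually_elim simp
  thus ?thesis by simp
qed

lemma right_mode_open:
  assumes "open S" "t \<in> S" "\<And>u. u \<in> S \<Longrightarrow> \<sigma> u = i"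
  shows "right_mode \<sigma> t = i"
proof (rule right_mode_eqI)
  have "\<forall>\<^sub>F u in nhds t. u \<in> S" using assms(1,2) by (rule eventually_nhds_in_open)
  hence "\<forall>\<^sub>F u in nhds t. u \<in> {t<..} \<longrightarrow> \<sigma> u = i"
    by eventually_elim (use assms(3) in auto)
  thus "\<forall>\<^sub>F u in at_right t. \<sigma> u = i" by (auto simp: eventually_at_filter elim: eventually_mono)
qed

text \<open>Finitely many discontinuities in a bounded window leave a gap to the right of t. On this
  gap the image of the signal is connected and finite, hence a single value.\<close>

lemma switching_signal_right:
  assumes "switching_signal \<sigma>"
  shows "\<exists>b>t. \<forall>u\<in>{t<..<b}. isCont \<sigma> u \<and> \<sigma> u = right_mode \<sigma> t"
proof -
  define D where "D = {u \<in> {t..t+1}. \<not> isCont \<sigma> u} - {t}"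
  have "finite D" using assms by (auto simp: D_def switching_signal_def)
  hence "open (- D)" by (intro open_Compl finite_imp_closed)
  moreover have "t \<in> - D" by (simp add: D_def)
  ultimately have "\<forall>\<^sub>F u in nhds t. u \<in> - D" by (rule eventually_nhds_in_open)
  moreover have "\<forall>\<^sub>F u in nhds t. u \<in> {t-1<..<t+1}"
    by (intro eventually_nhds_in_open) auto
  ultimately have "\<forall>\<^sub>F u in nhds t. u \<noteq> t \<longrightarrow> u \<in> {t<..} \<longrightarrow> isCont \<sigma> u"
    by eventually_elim (auto simp: D_def)
  hence "\<forall>\<^sub>F u in at_right t. isCont \<sigma> u" by (simp add: eventually_at_filter)
  then obtain b where b: "b > t" "\<And>u. u > t \<Longrightarrow> u < b \<Longrightarrow> isCont \<sigma> u"
    unfolding eventually_at_right_field by blast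
  have "isCont (\<lambda>u. real (\<sigma> u)) u" if "u \<in> {t<..<b}" for u
  proof -
    have "\<forall>\<^sub>F w in nhds u. real (\<sigma> w) = real (\<sigma> u)"
      using b(2)[of u] that unfolding isCont_nat_iff_locally_constant
      by (auto elim: eventually_mono)
    hence "((\<lambda>u. real (\<sigma> u)) \<longlongrightarrow> real (\<sigma> u)) (nhds u)" by (rule tendsto_eventually)
    thus ?thesis
      unfolding isCont_def using tendsto_at_iff_tendsto_nhds[of "\<lambda>u. real (\<sigma> u)" u] by blast
  qed
  hence "connected ((\<lambda>u. real (\<sigma> u)) ` {t<..<b})"
    by (intro connected_continuous_image continuous_at_imp_continuous_on) auto
  moreover have "finite ((\<lambda>u. real (\<sigma> u)) ` {t<..<b})"
  proof (rule finite_subset[of _ "real ` {1, 2}"])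
    have "\<sigma> u \<in> {1, 2}" for u using assms by (simp add: switching_signal_def)
    thus "(\<lambda>u. real (\<sigma> u)) ` {t<..<b} \<subseteq> real ` {1, 2}" by (intro image_subsetI imageI)
  qed simp
  moreover have "(\<lambda>u. real (\<sigma> u)) ` {t<..<b} \<noteq> {}" using b(1) by simp
  ultimately obtain c where c: "(\<lambda>u. real (\<sigma> u)) ` {t<..<b} = {c}"
    using connected_finite_iff_sing[of "(\<lambda>u. real (\<sigma> u)) ` {t<..<b}"] by blast
  define j where "j = \<sigma> ((t + b) / 2)"
  have c: "\<sigma> u = j" if "u \<in> {t<..<b}" for u
  proof -
    have "(t + b) / 2 \<in> {t<..<b}" using b(1) by simp
    hence "real (\<sigma> u) = c" "real (\<sigma> ((t + b) / 2)) = c" using c that by blast+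
    thus ?thesis by (simp add: j_def)
  qed
  have "right_mode \<sigma> t = j"
    by (rule right_mode_eqI) (use b(1) c in \<open>auto simp: eventually_at_right_field\<close>)
  thus ?thesis using b c by (intro exI[of _ b]) auto
qed

lemma right_mode_12:
  assumes "switching_signal \<sigma>"
  shows "right_mode \<sigma> t \<in> {1, 2}"
proof -
  obtain b where b: "b > t" "\<forall>u\<in>{t<..<b}. \<sigma> u = right_mode \<sigma> t"
    using switching_signal_right[OF assms] by blast
  obtain u where "u \<in> {t<..<b}" using b(1) dense by auto
  thus ?thesis using b(2) assms unfolding switching_signal_def by metis
qed

text \<open>Here \<open>w\<close> stands for y' and \<open>Et i *v w\<close> for y:
  \<open>dissip\<close> bounds half the derivative of the energy y \<bullet> P y, and
  \<open>bound\<close> controls x = F y' by y.\<close>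

locale reduced_switched =
  fixes E A :: "nat \<Rightarrow> real^'n^'n" and Y F :: "nat \<Rightarrow> real^'r^'n" and Et :: "nat \<Rightarrow> real^'r^'r"
    and P :: "real^'r^'r" and \<alpha> C :: real
  assumes reduce: "\<And>i x v. i \<in> {1, 2} \<Longrightarrow> E i *v v = A i *v x \<Longrightarrow>
      x = F i *v (transpose (Y i) *v v) \<and> transpose (Y i) *v x = Et i *v (transpose (Y i) *v v)"
    and dissip: "\<And>i w. i \<in> {1, 2} \<Longrightarrow> w \<in> range ((*v) (Et i)) \<Longrightarrow>
      w \<bullet> (P *v (Et i *v w)) \<le> - \<alpha> * ((Et i *v w) \<bullet> (P *v (Et i *v w)))"
    and bound: "\<And>i w. i \<in> {1, 2} \<Longrightarrow> w \<in> range ((*v) (Et i)) \<Longrightarrow> norm (F i *v w) \<le> C * norm (Et i *v w)"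
    and sym: "transpose P = P"
begin

text \<open>Reading the mode from the right matches the right-continuity of x at switching
  instants.\<close>

definition red :: "(real \<Rightarrow> nat) \<Rightarrow> (real \<Rightarrow> real^'n) \<Rightarrow> real \<Rightarrow> real^'r" where
  "red \<sigma> x t = transpose (Y (right_mode \<sigma> t)) *v x t"

context
  fixes \<sigma> :: "real \<Rightarrow> nat" and t0 :: real and x :: "real \<Rightarrow> real^'n"
  assumes sig: "switching_signal \<sigma>" and sol: "switched_solution E A Y \<sigma> t0 x"
begin

lemma solution_flow:
  "t > t0 \<Longrightarrow> isCont \<sigma> t \<Longrightarrow> \<exists>v. (x has_vector_derivative v) (at t) \<and> E (\<sigma> t) *v v = A (\<sigma> t) *v x t"
  using sol unfolding switched_solution_def by (elim conjE) blast

lemma solution_jump: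
  "t > t0 \<Longrightarrow> \<not> isCont \<sigma> t \<Longrightarrow> (x \<longlongrightarrow> x t) (at_right t) \<and>
    (\<exists>xm i j. (x \<longlongrightarrow> xm) (at_left t) \<and> (\<sigma> \<longlongrightarrow> i) (at_left t) \<and> (\<sigma> \<longlongrightarrow> j) (at_right t) \<and>
       transpose (Y j) *v x t = transpose (Y i) *v xm)"
proof -
  assume t: "t > t0" "\<not> isCont \<sigma> t"
  obtain xm xp i j where j: "(x \<longlongrightarrow> xm) (at_left t)" "(x \<longlongrightarrow> xp) (at_right t)"
      "(\<sigma> \<longlongrightarrow> i) (at_left t)" "(\<sigma> \<longlongrightarrow> j) (at_right t)"
      "x t = xp" "transpose (Y j) *v xp = transpose (Y i) *v xm"
    using sol t unfolding switched_solution_def by (elim conjE) blast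
  show ?thesis unfolding \<open>x t = xp\<close> using j by blast
qed

lemma red_derivative:
  assumes t: "t > t0" "isCont \<sigma> t"
  shows "\<exists>i\<in>{1,2}. \<exists>w\<in>range ((*v) (Et i)). (red \<sigma> x has_vector_derivative w) (at t) \<and>
     x t = F i *v w \<and> red \<sigma> x t = Et i *v w"
proof -
  define i where "i = \<sigma> t"
  have i12: "i \<in> {1, 2}" using sig by (simp add: i_def switching_signal_def)
  obtain S0 where S0: "open S0" "t \<in> S0" "\<And>u. u \<in> S0 \<Longrightarrow> \<sigma> u = i"
    using t(2) unfolding isCont_nat_iff_locally_constant eventually_nhds i_def by blast
  define S where "S = S0 \<inter> {t0<..}"
  have S: "open S" "t \<in> S" "\<And>u. u \<in> S \<Longrightarrow> \<sigma> u = i" "\<And>u. u \<in> S \<Longrightarrow> u > t0"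
    using S0 t by (auto simp: S_def)
  have red_S: "red \<sigma> x u = transpose (Y i) *v x u" if "u \<in> S" for u
    using right_mode_open[OF S(1) that S(3)] by (simp add: red_def)
  have deq: "\<exists>v. (x has_vector_derivative v) (at u) \<and> E i *v v = A i *v x u" if "u \<in> S" for u
    using solution_flow[OF S(4)[OF that] isCont_nat_if_constant_open[OF S(1) that S(3)]] S(3)[OF that]
    by simp
  obtain v where v: "(x has_vector_derivative v) (at t)" "E i *v v = A i *v x t" using deq[OF S(2)] by blast
  define w where "w = transpose (Y i) *v v"
  have "((\<lambda>u. transpose (Y i) *v x u) has_vector_derivative w) (at t)"
    unfolding w_def
    by (rule bounded_linear.has_vector_derivative[OF matrix_vector_mul_bounded_linear v(1)])
  hence der: "(red \<sigma> x has_vector_derivative w) (at t)"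
    by (rule has_vector_derivative_transform_within_open[OF _ S(1,2)]) (simp add: red_S)
  have xt: "x t = F i *v w" "red \<sigma> x t = Et i *v w"
    using reduce[OF i12 v(2)] unfolding red_S[OF S(2)] w_def by auto
  \<comment> \<open>The differential equation holds on a whole neighbourhood, so y stays in the
    range there and its derivative inherits this.\<close>
  have "red \<sigma> x u \<in> range ((*v) (Et i))" if u: "u \<in> S" for u
  proof -
    obtain v where "E i *v v = A i *v x u" using deq[OF u] by blast
    thus ?thesis using reduce[OF i12] red_S[OF u] by auto
  qed
  hence "\<forall>\<^sub>F u in nhds t. red \<sigma> x u \<in> range ((*v) (Et i))"
    using eventually_nhds_in_open[OF S(1,2)] by (auto elim: eventually_mono)
  moreover have "subspace (range ((*v) (Et i)))" by (intro linear_subspace_image) auto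
  ultimately have "w \<in> range ((*v) (Et i))"
    using has_vector_derivative_in_subspace der by blast
  thus ?thesis using i12 der xt by blast
qed

lemma solution_right:
  assumes "t \<ge> t0"
  shows "(x \<longlongrightarrow> x t) (at_right t)"
proof (cases "t = t0")
  case True thus ?thesis using sol by (simp add: switched_solution_def)
next
  case False
  hence t: "t > t0" using assms by simp
  show ?thesis
  proof (cases "isCont \<sigma> t")
    case True
    then obtain v where "(x has_vector_derivative v) (at t)"
      using solution_flow t by blast
    hence "isCont x t" by (rule has_vector_derivative_continuous)
    thus ?thesis unfolding isCont_def by (rule tendsto_within_subset) simp
  next
    case False
    thus ?thesis using solution_jump t by blast
  qed
qed

lemma red_right:
  assumes "t \<ge> t0"
  shows "(red \<sigma> x \<longlongrightarrow> red \<sigma> x t) (at_right t)"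
proof -
  obtain b where b: "b > t" "\<forall>u\<in>{t<..<b}. isCont \<sigma> u \<and> \<sigma> u = right_mode \<sigma> t"
    using switching_signal_right[OF sig] by blast
  have rm: "right_mode \<sigma> u = right_mode \<sigma> t" if "u \<in> {t<..<b}" for u
    by (rule right_mode_open[of "{t<..<b}"]) (use that b in auto)
  have "((\<lambda>u. transpose (Y (right_mode \<sigma> t)) *v x u) \<longlongrightarrow> red \<sigma> x t) (at_right t)"
    unfolding red_def
    by (rule bounded_linear.tendsto[OF matrix_vector_mul_bounded_linear solution_right[OF assms]])
  moreover have "\<forall>\<^sub>F u in at_right t. transpose (Y (right_mode \<sigma> t)) *v x u = red \<sigma> x u"
    unfolding eventually_at_right_field using b(1) rm by (intro exI[of _ b]) (simp add: red_def)
  ultimately show ?thesis by (rule Lim_transform_eventually)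
qed

text \<open>This is where the jump rule enters: the left limit, formed with the old mode, equals the
  value formed with the new one.\<close>

lemma red_left:
  assumes t: "t > t0"
  shows "(red \<sigma> x \<longlongrightarrow> red \<sigma> x t) (at_left t)"
proof (cases "isCont \<sigma> t")
  case True
  then obtain w where "(red \<sigma> x has_vector_derivative w) (at t)" using red_derivative t by blast
  hence "isCont (red \<sigma> x) t" by (rule has_vector_derivative_continuous)
  thus ?thesis unfolding isCont_def by (rule tendsto_within_subset) simp
next
  case False
  then obtain xm i j where j: "(x \<longlongrightarrow> xm) (at_left t)" "(\<sigma> \<longlongrightarrow> i) (at_left t)" "(\<sigma> \<longlongrightarrow> j) (at_right t)"
      "transpose (Y j) *v x t = transpose (Y i) *v xm"
    using solution_jump[OF t] by blast
  have rj: "right_mode \<sigma> t = j" by (rule right_mode_eqI[OF eventually_eq_discrete[OF j(3)]])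
  obtain b where b: "b < t" "\<And>u. u > b \<Longrightarrow> u < t \<Longrightarrow> \<sigma> u = i"
    using eventually_eq_discrete[OF j(2)] unfolding eventually_at_left_field by blast
  have rm: "right_mode \<sigma> u = i" if "u > b" "u < t" for u
    by (rule right_mode_open[of "{b<..<t}"]) (use that b in auto)
  have "((\<lambda>u. transpose (Y i) *v x u) \<longlongrightarrow> red \<sigma> x t) (at_left t)"
    unfolding red_def rj j(4)
    by (rule bounded_linear.tendsto[OF matrix_vector_mul_bounded_linear j(1)])
  moreover have "\<forall>\<^sub>F u in at_left t. transpose (Y i) *v x u = red \<sigma> x u"
    unfolding eventually_at_left_field using b(1) rm by (intro exI[of _ b]) (simp add: red_def)
  ultimately show ?thesis by (rule Lim_transform_eventually)
qed

lemma red_continuous: "continuous_on {t0..T} (red \<sigma> x)"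
  unfolding continuous_on_def
proof
  fix t assume t: "t \<in> {t0..T}"
  show "(red \<sigma> x \<longlongrightarrow> red \<sigma> x t) (at t within {t0..T})"
  proof (cases "t = t0")
    case True
    have "(red \<sigma> x \<longlongrightarrow> red \<sigma> x t) (at t within {t..})"
      using red_right[of t] t by (simp add: at_within_Ici_at_right)
    thus ?thesis by (rule tendsto_within_subset) (use True in auto)
  next
    case False
    hence "(red \<sigma> x \<longlongrightarrow> red \<sigma> x t) (at t)"
      using red_left[of t] red_right[of t] t by (simp add: filterlim_at_split)
    thus ?thesis by (rule tendsto_within_subset) simp
  qed
qed

lemma red_energy_decay:
  assumes T: "T \<ge> t0"
  shows "red \<sigma> x T \<bullet> (P *v red \<sigma> x T) \<le> exp (- (2 * \<alpha> * (T - t0))) * (red \<sigma> x t0 \<bullet> (P *v red \<sigma> x t0))"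
proof -
  let ?y = "red \<sigma> x"
  \<comment> \<open>The energy weighted by its expected decay; the rate is 2 \<alpha> because energy
    is quadratic in y.\<close>
  define f where "f t = exp (2 * \<alpha> * (t - t0)) * (?y t \<bullet> (P *v ?y t))" for t
  have "f T \<le> f t0"
  proof (rule nonincreasing_finite_exceptions[OF T])
    show "continuous_on {t0..T} f"
      unfolding f_def
      by (intro continuous_intros red_continuous linear_continuous_on_compose[OF red_continuous]) simp
    show "finite {t \<in> {t0..T}. \<not> isCont \<sigma> t}" using sig by (simp add: switching_signal_def)
    fix t assume "t \<in> {t0<..<T} - {t \<in> {t0..T}. \<not> isCont \<sigma> t}"
    hence t: "t > t0" "isCont \<sigma> t" by auto
    obtain i w where i: "i \<in> {1,2}" and w: "w \<in> range ((*v) (Et i))"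
      and der: "(?y has_vector_derivative w) (at t)" and yt: "?y t = Et i *v w"
      using red_derivative[OF t] by blast
    have derP: "((\<lambda>t. P *v ?y t) has_vector_derivative P *v w) (at t)"
      by (rule bounded_linear.has_vector_derivative[OF matrix_vector_mul_bounded_linear der])
    have "((\<lambda>t. ?y t \<bullet> (P *v ?y t)) has_vector_derivative (?y t \<bullet> (P *v w) + w \<bullet> (P *v ?y t))) (at t)"
      by (rule bounded_bilinear.has_vector_derivative[OF bounded_bilinear_inner der derP])
    moreover have "?y t \<bullet> (P *v w) = w \<bullet> (P *v ?y t)" by (metis sym inner_commute inner_transpose_matvec)
    ultimately have derV: "((\<lambda>t. ?y t \<bullet> (P *v ?y t)) has_real_derivative 2 * (w \<bullet> (P *v ?y t))) (at t)"
      by (simp add: has_real_derivative_iff_has_vector_derivative)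
    let ?D = "exp (2 * \<alpha> * (t - t0)) * (2 * (w \<bullet> (P *v ?y t)))
        + exp (2 * \<alpha> * (t - t0)) * (2 * \<alpha>) * (?y t \<bullet> (P *v ?y t))"
    have "(f has_real_derivative ?D) (at t)"
      unfolding f_def by (rule derivative_eq_intros derV refl | simp)+
    moreover have "?D \<le> 0"
    proof -
      have "?D = 2 * exp (2 * \<alpha> * (t - t0)) * (w \<bullet> (P *v ?y t) + \<alpha> * (?y t \<bullet> (P *v ?y t)))"
        by (simp add: algebra_simps)
      moreover have "w \<bullet> (P *v ?y t) + \<alpha> * (?y t \<bullet> (P *v ?y t)) \<le> 0"
        using dissip[OF i w] unfolding yt by simp
      ultimately show ?thesis by (simp add: mult_nonneg_nonpos)
    qed
    ultimately show "\<exists>D\<le>0. (f has_real_derivative D) (at t)" by blast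
  qed
  hence "exp (2 * \<alpha> * (T - t0)) * (?y T \<bullet> (P *v ?y T)) \<le> ?y t0 \<bullet> (P *v ?y t0)" by (simp add: f_def)
  hence "exp (- (2 * \<alpha> * (T - t0))) * (exp (2 * \<alpha> * (T - t0)) * (?y T \<bullet> (P *v ?y T)))
      \<le> exp (- (2 * \<alpha> * (T - t0))) * (?y t0 \<bullet> (P *v ?y t0))"
    by (rule mult_left_mono) simp
  thus ?thesis by (simp flip: mult.assoc exp_add)
qed

text \<open>At continuity points x = F w and y = Et w. Switching instants and \<open>t0\<close>
  itself are reached as limits from the right.\<close>

lemma solution_le_red:
  assumes t: "t \<ge> t0"
  shows "norm (x t) \<le> C * norm (red \<sigma> x t)"
proof -
  have le: "norm (x u) \<le> C * norm (red \<sigma> x u)" if "u > t0" "isCont \<sigma> u" for u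
    using red_derivative[OF that] bound by metis
  obtain b where b: "b > t" "\<forall>u\<in>{t<..<b}. isCont \<sigma> u \<and> \<sigma> u = right_mode \<sigma> t"
    using switching_signal_right[OF sig] by blast
  have "\<forall>\<^sub>F u in at_right t. norm (x u) \<le> C * norm (red \<sigma> x u)"
    unfolding eventually_at_right_field using b t by (intro exI[of _ b]) (auto intro!: le)
  moreover have "((\<lambda>u. norm (x u)) \<longlongrightarrow> norm (x t)) (at_right t)"
    by (intro tendsto_intros solution_right t)
  moreover have "((\<lambda>u. C * norm (red \<sigma> x u)) \<longlongrightarrow> C * norm (red \<sigma> x t)) (at_right t)"
    by (intro tendsto_intros red_right t)
  ultimately show ?thesis by (intro tendsto_le[of "at_right t"]) auto
qed

end

end

section \<open>Uniform constants and the exponential estimate\<close>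

lemma quadratic_form_neg_bound:
  fixes M :: "real^'r^'r"
  assumes V: "subspace V" and neg: "\<And>w. w \<in> V \<Longrightarrow> w \<noteq> 0 \<Longrightarrow> w \<bullet> (M *v w) < 0"
  shows "\<exists>c>0. \<forall>w\<in>V. w \<bullet> (M *v w) \<le> - c * (norm w)\<^sup>2"
\<comment> \<open>\<open>V\<close> may be trivial, and the maximum is attained only on a nonempty
  set.\<close>
proof (cases "V \<inter> sphere 0 1 = {}")
  case True
  have "w = 0" if "w \<in> V" for w
  proof (rule ccontr)
    assume "w \<noteq> 0"
    hence "w /\<^sub>R norm w \<in> V \<inter> sphere 0 1" using that V by (simp add: subspace_scale)
    thus False using True by blast
  qed
  hence "\<forall>w\<in>V. w \<bullet> (M *v w) \<le> - 1 * (norm w)\<^sup>2"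
    by (metis inner_zero_left mult_zero_right norm_zero order_refl zero_power2)
  thus ?thesis by (intro exI[of _ 1]) simp
next
  case False
  have "compact (V \<inter> sphere 0 1)"
    using closed_subspace[OF V] by (intro closed_Int_compact) auto
  moreover have "continuous_on (V \<inter> sphere 0 1) (\<lambda>w. w \<bullet> (M *v w))"
    by (intro continuous_intros linear_continuous_on_compose[OF continuous_on_id]) simp
  ultimately have "\<exists>z\<in>V \<inter> sphere 0 1. \<forall>w\<in>V \<inter> sphere 0 1. w \<bullet> (M *v w) \<le> z \<bullet> (M *v z)"
    using False by (intro continuous_attains_sup)
  then obtain z where z: "z \<in> V \<inter> sphere 0 1" "\<And>w. w \<in> V \<inter> sphere 0 1 \<Longrightarrow> w \<bullet> (M *v w) \<le> z \<bullet> (M *v z)"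
    by blast
  define c where "c = - (z \<bullet> (M *v z))"
  have "z \<noteq> 0" using z(1) by auto
  hence "c > 0" using neg[of z] z(1) by (simp add: c_def)
  moreover have "w \<bullet> (M *v w) \<le> - c * (norm w)\<^sup>2" if "w \<in> V" for w
  proof (cases "w = 0")
    case False
    hence "w /\<^sub>R norm w \<in> V \<inter> sphere 0 1" using that V by (simp add: subspace_scale)
    hence "(w /\<^sub>R norm w) \<bullet> (M *v (w /\<^sub>R norm w)) \<le> - c"
      unfolding c_def minus_minus by (rule z(2))
    hence "(norm w)\<^sup>2 * ((w /\<^sub>R norm w) \<bullet> (M *v (w /\<^sub>R norm w))) \<le> (norm w)\<^sup>2 * (- c)"
      by (rule mult_left_mono) simp
    moreover have "(norm w)\<^sup>2 * ((w /\<^sub>R norm w) \<bullet> (M *v (w /\<^sub>R norm w))) = w \<bullet> (M *v w)"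
      using False by (simp add: matrix_vector_mult_scaleR power2_eq_square field_simps)
    ultimately show ?thesis by (simp add: mult.commute)
  qed simp
  ultimately show ?thesis by blast
qed

lemma quadratic_form_upper_bound:
  fixes M :: "real^'r^'r"
  shows "\<exists>K>0. \<forall>y. y \<bullet> (M *v y) \<le> K * (norm y)\<^sup>2"
proof -
  obtain K where K: "K > 0" "\<And>y. norm (M *v y) \<le> norm y * K"
    using bounded_linear.pos_bounded[OF matrix_vector_mul_bounded_linear[of M]] by blast
  have "y \<bullet> (M *v y) \<le> K * (norm y)\<^sup>2" for y
  proof -
    have "y \<bullet> (M *v y) \<le> norm y * norm (M *v y)" by (rule norm_cauchy_schwarz)
    also have "\<dots> \<le> norm y * (norm y * K)" by (intro mult_left_mono K) simp
    finally show ?thesis by (simp add: power2_eq_square mult_ac)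
  qed
  thus ?thesis using K(1) by blast
qed

text \<open>Strict negativity on the range of \<open>M\<close> also makes \<open>M\<close> injective
  there, hence bounded below; this yields the constant \<open>C\<close>.\<close>

lemma mode_constants:
  fixes M P :: "real^'r^'r" and F :: "real^'r^'n"
  assumes neg: "\<And>w. w \<in> range ((*v) M) \<Longrightarrow> w \<noteq> 0 \<Longrightarrow> w \<bullet> (P *v (M *v w)) < 0"
  shows "\<exists>\<alpha>>0. \<exists>C>0. \<forall>w\<in>range ((*v) M).
     w \<bullet> (P *v (M *v w)) \<le> - \<alpha> * ((M *v w) \<bullet> (P *v (M *v w))) \<and> norm (F *v w) \<le> C * norm (M *v w)"
proof -
  let ?V = "range ((*v) M)"
  have V: "subspace ?V" by (intro linear_subspace_image) auto
  obtain c where c: "c > 0" "\<And>w. w \<in> ?V \<Longrightarrow> w \<bullet> ((P ** M) *v w) \<le> - c * (norm w)\<^sup>2"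
    using quadratic_form_neg_bound[OF V, of "P ** M"] neg by (auto simp flip: matrix_vector_mul_assoc)
  obtain K where K: "K > 0" "\<And>y. y \<bullet> (P *v y) \<le> K * (norm y)\<^sup>2"
    using quadratic_form_upper_bound[of P] by blast
  obtain L where L: "L > 0" "\<And>y. norm (M *v y) \<le> norm y * L"
    using bounded_linear.pos_bounded[OF matrix_vector_mul_bounded_linear[of M]] by blast
  obtain G where G: "G > 0" "\<And>y. norm (F *v y) \<le> norm y * G"
    using bounded_linear.pos_bounded[OF matrix_vector_mul_bounded_linear[of F]] by blast
  have "\<exists>e>0. \<forall>w\<in>?V. e * norm w \<le> norm (M *v w)"
  proof (rule injective_imp_isometric[OF closed_subspace[OF V] V matrix_vector_mul_bounded_linear])
    show "\<forall>w\<in>?V. M *v w = 0 \<longrightarrow> w = 0" using neg by force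
  qed
  then obtain e where e: "e > 0" "\<And>w. w \<in> ?V \<Longrightarrow> e * norm w \<le> norm (M *v w)" by blast
  \<comment> \<open>The energy at M w is at most K L^2 |w|^2, so \<alpha> times it is at most c
    |w|^2.\<close>
  define \<alpha> where "\<alpha> = c / (K * L\<^sup>2)"
  have "w \<bullet> (P *v (M *v w)) \<le> - \<alpha> * ((M *v w) \<bullet> (P *v (M *v w)))" if "w \<in> ?V" for w
  proof -
    have "(M *v w) \<bullet> (P *v (M *v w)) \<le> K * (norm (M *v w))\<^sup>2" by (rule K)
    also have "\<dots> \<le> K * (norm w * L)\<^sup>2" using K L by (intro mult_left_mono power_mono) auto
    finally have "\<alpha> * ((M *v w) \<bullet> (P *v (M *v w))) \<le> \<alpha> * (K * (norm w * L)\<^sup>2)"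
      using c K L by (intro mult_left_mono) (auto simp: \<alpha>_def)
    also have "\<dots> = c * (norm w)\<^sup>2" using K L by (simp add: \<alpha>_def power_mult_distrib)
    finally show ?thesis using c(2)[OF that] by (simp flip: matrix_vector_mul_assoc)
  qed
  moreover have "norm (F *v w) \<le> (G / e) * norm (M *v w)" if "w \<in> ?V" for w
  proof -
    have "norm w \<le> norm (M *v w) / e" using e(1) e(2)[OF that] by (simp add: field_simps)
    hence "norm w * G \<le> norm (M *v w) / e * G" using G by (intro mult_right_mono) auto
    thus ?thesis using G(2)[of w] by (simp add: mult.commute)
  qed
  moreover have "\<alpha> > 0" using c K L by (simp add: \<alpha>_def)
  moreover have "G / e > 0" using G e by simp
  ultimately show ?thesis by blast
qed

lemma switched_descriptor_GUES:
  fixes E A :: "nat \<Rightarrow> real^'n^'n" and Y F :: "nat \<Rightarrow> real^'r^'n" and Et :: "nat \<Rightarrow> real^'r^'r"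
    and P :: "real^'r^'r"
  assumes reduce: "\<And>i x v. i \<in> {1, 2} \<Longrightarrow> E i *v v = A i *v x \<Longrightarrow>
      x = F i *v (transpose (Y i) *v v) \<and> transpose (Y i) *v x = Et i *v (transpose (Y i) *v v)"
    and sym: "transpose P = P" and pos: "\<And>y. y \<noteq> 0 \<Longrightarrow> y \<bullet> (P *v y) > 0"
    and neg: "\<And>i w. i \<in> {1, 2} \<Longrightarrow> w \<in> range ((*v) (Et i)) \<Longrightarrow> w \<noteq> 0 \<Longrightarrow> w \<bullet> (P *v (Et i *v w)) < 0"
  shows "GUES E A Y"
proof -
  have pos0: "y \<bullet> (P *v y) \<ge> 0" for y using pos[of y] by (cases "y = 0") auto
  have "\<forall>i\<in>{1, 2}. \<exists>\<alpha>>0. \<exists>C>0. \<forall>w\<in>range ((*v) (Et i)).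
     w \<bullet> (P *v (Et i *v w)) \<le> - \<alpha> * ((Et i *v w) \<bullet> (P *v (Et i *v w))) \<and> norm (F i *v w) \<le> C * norm (Et i *v w)"
    by (intro ballI mode_constants neg)
  then obtain a C where aC: "\<And>i. i \<in> {1, 2} \<Longrightarrow> a i > 0" "\<And>i. i \<in> {1, 2} \<Longrightarrow> C i > 0"
    "\<And>i w. i \<in> {1, 2} \<Longrightarrow> w \<in> range ((*v) (Et i)) \<Longrightarrow>
       w \<bullet> (P *v (Et i *v w)) \<le> - a i * ((Et i *v w) \<bullet> (P *v (Et i *v w)))"
    "\<And>i w. i \<in> {1, 2} \<Longrightarrow> w \<in> range ((*v) (Et i)) \<Longrightarrow> norm (F i *v w) \<le> C i * norm (Et i *v w)"
    by metis
  define \<alpha> where "\<alpha> = min (a 1) (a 2)"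
  define D where "D = max (C 1) (C 2)"
  have \<alpha>: "\<alpha> > 0" using aC(1) by (simp add: \<alpha>_def)
  have D: "D > 0" using aC(2)[of 1] by (simp add: D_def less_max_iff_disj)
  have \<alpha>_le: "\<alpha> \<le> a i" and D_ge: "C i \<le> D" if "i \<in> {1, 2}" for i
    using that by (auto simp: \<alpha>_def D_def)
  interpret reduced_switched E A Y F Et P \<alpha> D
  proof
    fix i w assume i: "i \<in> {1, 2::nat}" and w: "w \<in> range ((*v) (Et i))"
    show "w \<bullet> (P *v (Et i *v w)) \<le> - \<alpha> * ((Et i *v w) \<bullet> (P *v (Et i *v w)))"
      using aC(3)[OF i w] mult_right_mono[OF \<alpha>_le[OF i] pos0[of "Et i *v w"]] by simp
    show "norm (F i *v w) \<le> D * norm (Et i *v w)"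
      using aC(4)[OF i w] mult_right_mono[OF D_ge[OF i] norm_ge_zero[of "Et i *v w"]] by simp
  qed (use reduce sym in auto)
  obtain m where m: "m > 0" "\<And>y. m * (norm y)\<^sup>2 \<le> y \<bullet> (P *v y)"
    using quadratic_form_neg_bound[OF subspace_UNIV, of "- P"] pos by (auto simp: uminus_matvec)
  obtain K where K: "K > 0" "\<And>y. y \<bullet> (P *v y) \<le> K * (norm y)\<^sup>2"
    using quadratic_form_upper_bound[of P] by blast
  have "\<forall>i. \<exists>L>0. \<forall>x. norm (transpose (Y i) *v x) \<le> norm x * L"
    using bounded_linear.pos_bounded[OF matrix_vector_mul_bounded_linear] by blast
  then obtain L where L: "\<And>i. L i > 0" "\<And>i x. norm (transpose (Y i) *v x) \<le> norm x * L i" by metis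
  define M where "M = max (L 1) (L 2)"
  have M: "M > 0" using L(1) by (simp add: M_def less_max_iff_disj)
  \<comment> \<open>\<open>M\<close> passes from x(t0) to y(t0), sqrt (K / m) compares norm and
    energy at both ends, and \<open>D\<close> returns from y(t) to x(t).\<close>
  define \<beta> where "\<beta> = D * sqrt (K / m) * M"
  have \<beta>: "\<beta> > 0" using D K(1) m(1) M by (simp add: \<beta>_def)
  have "norm (x t) \<le> \<beta> * exp (- \<alpha> * (t - t0)) * norm (x t0)"
    if sig: "switching_signal \<sigma>" and sol: "switched_solution E A Y \<sigma> t0 x" and t: "t \<ge> t0" for \<sigma> t0 x t
  proof -
    let ?y = "red \<sigma> x"
    have "m * (norm (?y t))\<^sup>2 \<le> ?y t \<bullet> (P *v ?y t)" by (rule m(2))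
    also have "\<dots> \<le> exp (- (2 * \<alpha> * (t - t0))) * (?y t0 \<bullet> (P *v ?y t0))"
      by (rule red_energy_decay[OF sig sol t])
    also have "\<dots> \<le> exp (- (2 * \<alpha> * (t - t0))) * (K * (norm (?y t0))\<^sup>2)"
      by (intro mult_left_mono K(2)) simp
    also have "exp (- (2 * \<alpha> * (t - t0))) = (exp (- \<alpha> * (t - t0)))\<^sup>2"
      by (simp add: power2_eq_square flip: exp_add)
    finally have "(norm (?y t))\<^sup>2 \<le> (sqrt (K / m) * exp (- \<alpha> * (t - t0)) * norm (?y t0))\<^sup>2"
      using m(1) K(1) by (simp add: power_mult_distrib field_simps)
    hence y: "norm (?y t) \<le> sqrt (K / m) * exp (- \<alpha> * (t - t0)) * norm (?y t0)"
      by (rule power2_le_imp_le) (use m(1) K(1) in simp)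
    have y0: "norm (?y t0) \<le> M * norm (x t0)"
    proof -
      have "L (right_mode \<sigma> t0) \<le> M" using right_mode_12[OF sig, of t0] by (auto simp: M_def)
      hence "norm (x t0) * L (right_mode \<sigma> t0) \<le> norm (x t0) * M" by (intro mult_left_mono) auto
      thus ?thesis using L(2)[of "right_mode \<sigma> t0" "x t0"] unfolding red_def by (simp add: mult.commute)
    qed
    have "norm (x t) \<le> D * norm (?y t)" by (rule solution_le_red[OF sig sol t])
    also have "\<dots> \<le> D * (sqrt (K / m) * exp (- \<alpha> * (t - t0)) * (M * norm (x t0)))"
    proof (intro mult_left_mono order.trans[OF y])
      show "norm (?y t0) \<le> M * norm (x t0)" by (rule y0)
    qed (use D m(1) K(1) in auto)
    finally show ?thesis by (simp add: \<beta>_def mult_ac)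
  qed
  thus ?thesis unfolding GUES_def using \<alpha> \<beta> by blast
qed

theorem theorem5:
  fixes E A :: "nat \<Rightarrow> real^'n^'n" and X Y :: "nat \<Rightarrow> real^'r^'n"
    and Et :: "nat \<Rightarrow> real^'r^'r" and g h :: "real^'r"
  assumes inv: "\<And>i. i \<in> {1, 2} \<Longrightarrow> invertible (A i)"
    and frd: "\<And>i. i \<in> {1, 2} \<Longrightarrow> full_rank_decomp (E i) (X i) (Y i)"
    and Et_def: "\<And>i. i \<in> {1, 2} \<Longrightarrow> Et i = transpose (Y i) ** matrix_inv (A i) ** X i"
    and stab: "desc_stable (E 1) (A 1)" "desc_stable (E 2) (A 2)"
    and idx: "desc_index (E 1) (A 1) = 1" "desc_index (E 2) (A 2) = 2"
    and rank1: "Et 2 = Et 1 - outer g h"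
    and ctrb: "controllable (Et 1) g"
    and obsv: "observable h (Et 1)"
    and noneg: "\<forall>s::real. s < 0 \<longrightarrow> poly (char_poly (Et 1 ** Et 2)) s \<noteq> 0"
    and zero1: "order 0 (char_poly (Et 1 ** Et 2)) = 1"
  shows "GUES E A Y"
proof -
  define F where "F i = matrix_inv (A i) ** X i" for i
  have desc: "descriptor (E i) (A i) (X i) (Y i) (F i) (Et i)" if "i \<in> {1, 2}" for i
    using that inv frd by unfold_locales (auto simp: F_def Et_def matrix_mul_assoc)
  interpret d1: descriptor "E 1" "A 1" "X 1" "Y 1" "F 1" "Et 1" by (rule desc) simp
  interpret d2: descriptor "E 2" "A 2" "X 2" "Y 2" "F 2" "Et 2" by (rule desc) simp
  have "hurwitz_mat (Et 1)"
    by (rule d1.stable_hurwitz[OF stab(1) d1.index_one_injective[OF idx(1)]])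
  then obtain a U where "krylov_resolvent (Et 1) g a U" using krylov_resolvent_exists ctrb by blast
  then interpret krylov_resolvent "Et 1" g a U .
  obtain P where P: "transpose P = P" "\<And>x. x \<noteq> 0 \<Longrightarrow> x \<bullet> (P *v x) > 0"
    "\<And>w. w \<noteq> 0 \<Longrightarrow> w \<bullet> (P *v (Et 1 *v w)) < 0" "\<And>w. Et 2 *v w \<noteq> 0 \<Longrightarrow> w \<bullet> (P *v (Et 2 *v w)) < 0"
    using common_lyapunov_matrix[OF rank1 noneg zero1] by blast
  show ?thesis
  proof (rule switched_descriptor_GUES[OF _ P(1,2)])
    show "x = F i *v (transpose (Y i) *v v) \<and> transpose (Y i) *v x = Et i *v (transpose (Y i) *v v)"
      if "i \<in> {1, 2}" "E i *v v = A i *v x" for i x v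
      using descriptor.descriptor_eq[OF desc[OF that(1)] that(2)] by blast
    show "w \<bullet> (P *v (Et i *v w)) < 0" if iw: "i \<in> {1, 2}" "w \<in> range ((*v) (Et i))" "w \<noteq> 0" for i w
    proof (cases "i = 1")
      case True
      thus ?thesis using P(3) iw(3) by simp
    next
      case False
      hence i: "i = 2" using iw(1) by simp
      then obtain u where u: "w = Et 2 *v u" using iw(2) by blast
      \<comment> \<open>\<open>P\<close> controls mode 2 only off the kernel of \<open>Et 2\<close>;
        index two keeps nonzero vectors of the range off that kernel.\<close>
      hence "Et 2 *v w \<noteq> 0" using d2.index_two_kernel[OF idx(2), of u] iw(3) by auto
      thus ?thesis using P(4) i by blast
    qed
  qed
qed

end
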